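(* Let $n\ge 1$ and let $g\colon \mathbb{R}^n\to[0,\infty)$ be a symmetric norm. For $X,Y\in U(n)$ define $$d_g(X,Y) = g(|a_1|,\dots,|a_n|),$$ where $e^{ia_1},\dots,e^{ia_n}$ are the eigenvalues of $XY^{-1}$ (counted with multiplicity) with $\pi\ge a_1\ge\cdots\ge a_n>-\pi$, and define $$d^{\triangledown}_g(X,Y)=\inf_{r\in\mathbb{R}} g(|a_1(r)|,\dots,|a_n(r)|),$$ where, for each $r\in\mathbb{R}$, $e^{ia_1(r)},\dots,e^{ia_n(r)}$ are the eigenvalues of $e^{ir}XY^{-1}$ (counted with multiplicity) with $\pi\ge a_1(r)\ge\cdots\ge a_n(r)>-\pi$. Then $d_g$ is a metric on $U(n)$ and $d^{\triangledown}_g$ is a pseudo-metric on $U(n)$. Moreover, the infimum defining $d^{\triangledown}_g(X,Y)$ is a minimum, and it may be searched for in any compact interval of the form $[r_0,r_0+2\pi]$ with $r_0\in\mathbb{R}$.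
   Context: $U(n)$ is the group of all $n\times n$ complex unitary matrices. A symmetric norm $g\colon\mathbb{R}^n\to[0,\infty)$ is a norm on $\mathbb{R}^n$ such that $g(\mathbf{v})=g(\mathbf{v}P)$ for every row vector $\mathbf{v}\in\mathbb{R}^{1\times n}$ and every $n\times n$ matrix $P$ that is a permutation matrix or a diagonal (real) orthogonal matrix; that is, $g$ is invariant under permutations and sign changes of the coordinates. A pseudo-metric $d$ is a non-negative symmetric function with $d(X,X)=0$ satisfying the triangle inequality, where $d(X,Y)=0$ need not imply $X=Y$. *)

theory Defs
  imports
    "HOL-Analysis.Abstract_Metric_Spaces"
    "HOL-Algebra.Group"
    "HOL-Computational_Algebra.Fundamental_Theorem_Algebra"
    "Jordan_Normal_Form.Schur_Decomposition"
begin

definition unitary_mat :: "complex mat \<Rightarrow> bool" where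
  "unitary_mat A \<longleftrightarrow> square_mat A \<and> mat_adjoint A * A = 1\<^sub>m (dim_row A)"

definition unitary_group :: "nat \<Rightarrow> complex mat monoid" where
  "unitary_group n =
     \<lparr>carrier = {A \<in> carrier_mat n n. unitary_mat A}, monoid.mult = (*), one = 1\<^sub>m n\<rparr>"

definition permutation_mat :: "nat \<Rightarrow> real mat \<Rightarrow> bool" where
  "permutation_mat n P \<longleftrightarrow>
     (\<exists>p. p permutes {..<n} \<and> P = mat n n (\<lambda>(i, j). if j = p i then 1 else 0))"

text \<open>\<^const>\<open>orthogonal_mat\<close> only asks the columns to be pairwise orthogonal and nonzero,
  so orthogonality in the usual sense is written out.\<close>

definition diagonal_orthogonal_mat :: "nat \<Rightarrow> real mat \<Rightarrow> bool" where
  "diagonal_orthogonal_mat n P \<longleftrightarrow>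
     P \<in> carrier_mat n n \<and> diagonal_mat P \<and> P * transpose_mat P = 1\<^sub>m n"

text \<open>A function on \<open>\<real>\<^sup>n\<close> is a function on all real vectors of which only the values on
  \<^term>\<open>carrier_vec n\<close> matter. For a row vector \<open>v\<close>, the product \<open>v P\<close> is
  \<^term>\<open>transpose_mat P *\<^sub>v v\<close>.\<close>

locale symmetric_norm =
  fixes n :: nat and g :: "real vec \<Rightarrow> real"
  assumes nonneg: "v \<in> carrier_vec n \<Longrightarrow> 0 \<le> g v"
    and eq_zero_iff: "v \<in> carrier_vec n \<Longrightarrow> g v = 0 \<longleftrightarrow> v = 0\<^sub>v n"
    and smult: "v \<in> carrier_vec n \<Longrightarrow> g (c \<cdot>\<^sub>v v) = \<bar>c\<bar> * g v"
    and triangle: "v \<in> carrier_vec n \<Longrightarrow> w \<in> carrier_vec n \<Longrightarrow> g (v + w) \<le> g v + g w"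
    and invariant: "v \<in> carrier_vec n \<Longrightarrow> permutation_mat n P \<or> diagonal_orthogonal_mat n P
      \<Longrightarrow> g (transpose_mat P *\<^sub>v v) = g v"

text \<open>Parallel to \<^locale>\<open>Metric_space\<close>, whose \<open>nonneg\<close> and \<open>commute\<close> are not relativised to the
  carrier either.\<close>

locale Pseudometric_space =
  fixes M :: "'a set" and d :: "'a \<Rightarrow> 'a \<Rightarrow> real"
  assumes nonneg: "0 \<le> d x y"
    and commute: "d x y = d y x"
    and refl: "x \<in> M \<Longrightarrow> d x x = 0"
    and triangle: "x \<in> M \<Longrightarrow> y \<in> M \<Longrightarrow> z \<in> M \<Longrightarrow> d x z \<le> d x y + d y z"

text \<open>The arguments in \<open>(-\<pi>, \<pi>]\<close> of the eigenvalues, with algebraic multiplicity, in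
  descending order; see \<open>eigenangles_eq_iff\<close> below.\<close>

definition eigenangles :: "complex mat \<Rightarrow> real list" where
  "eigenangles A = rev (sorted_list_of_multiset (image_mset Arg (proots (char_poly A))))"

definition angle_gauge :: "(real vec \<Rightarrow> real) \<Rightarrow> complex mat \<Rightarrow> real" where
  "angle_gauge g A = g (vec_of_list (map abs (eigenangles A)))"

definition phase_gauge ::
  "nat \<Rightarrow> (real vec \<Rightarrow> real) \<Rightarrow> complex mat \<Rightarrow> complex mat \<Rightarrow> real \<Rightarrow> real" where
  "phase_gauge n g X Y r =
     angle_gauge g (cis r \<cdot>\<^sub>m (X \<otimes>\<^bsub>unitary_group n\<^esub> inv\<^bsub>unitary_group n\<^esub> Y))"

text \<open>The value 0 off the unitary group is only there because \<^locale>\<open>Metric_space\<close> asks for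
  symmetry and non-negativity on the whole type.\<close>

definition unitary_dist ::
  "nat \<Rightarrow> (real vec \<Rightarrow> real) \<Rightarrow> complex mat \<Rightarrow> complex mat \<Rightarrow> real" where
  "unitary_dist n g X Y =
     (if X \<in> carrier (unitary_group n) \<and> Y \<in> carrier (unitary_group n)
      then angle_gauge g (X \<otimes>\<^bsub>unitary_group n\<^esub> inv\<^bsub>unitary_group n\<^esub> Y) else 0)"

definition unitary_phase_dist ::
  "nat \<Rightarrow> (real vec \<Rightarrow> real) \<Rightarrow> complex mat \<Rightarrow> complex mat \<Rightarrow> real" where
  "unitary_phase_dist n g X Y =
     (if X \<in> carrier (unitary_group n) \<and> Y \<in> carrier (unitary_group n)
      then (INF r. phase_gauge n g X Y r) else 0)"

lemma mat_adjoint_dim [simp]: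
  "dim_row (mat_adjoint A) = dim_col A" "dim_col (mat_adjoint A) = dim_row A"
  by (simp_all add: mat_adjoint_def)

lemma mat_adjoint_carrier [simp]: "A \<in> carrier_mat m n \<Longrightarrow> mat_adjoint A \<in> carrier_mat n m"
  by (auto intro!: carrier_matI)

lemma mat_adjoint_index [simp]:
  "i < dim_col A \<Longrightarrow> j < dim_row A \<Longrightarrow> mat_adjoint A $$ (i, j) = conjugate (A $$ (j, i))"
  by (simp add: mat_adjoint_def mat_of_rows_def)

lemma mat_adjoint_adjoint [simp]: "mat_adjoint (mat_adjoint A) = (A :: complex mat)"
  by (rule eq_matI) simp_all

lemma mat_adjoint_one [simp]: "mat_adjoint (1\<^sub>m n) = (1\<^sub>m n :: complex mat)"
  by (rule eq_matI) auto

lemma mat_adjoint_mult: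
  fixes A B :: "complex mat"
  assumes "A \<in> carrier_mat m n" "B \<in> carrier_mat n k"
  shows "mat_adjoint (A * B) = mat_adjoint B * mat_adjoint A"
  by (rule eq_matI) (use assms in \<open>auto simp: scalar_prod_def cnj_sum intro!: sum.cong\<close>)

lemma unitary_groupD:
  assumes "A \<in> carrier (unitary_group n)"
  shows "A \<in> carrier_mat n n" "mat_adjoint A * A = 1\<^sub>m n" "A * mat_adjoint A = 1\<^sub>m n"
proof -
  show 1: "A \<in> carrier_mat n n" and 2: "mat_adjoint A * A = 1\<^sub>m n"
    using assms by (auto simp: unitary_group_def unitary_mat_def)
  show "A * mat_adjoint A = 1\<^sub>m n"
    using mat_mult_left_right_inverse[OF _ 1 2] 1 by simp
qed

lemma unitary_groupI:
  "A \<in> carrier_mat n n \<Longrightarrow> mat_adjoint A * A = 1\<^sub>m n \<Longrightarrow> A \<in> carrier (unitary_group n)"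
  by (auto simp: unitary_group_def unitary_mat_def)

lemma unitary_group_simps [simp]:
  "A \<otimes>\<^bsub>unitary_group n\<^esub> B = A * B" "\<one>\<^bsub>unitary_group n\<^esub> = 1\<^sub>m n"
  by (simp_all add: unitary_group_def)

lemma adjoint_in_unitary_group:
  assumes "A \<in> carrier (unitary_group n)" shows "mat_adjoint A \<in> carrier (unitary_group n)"
  using unitary_groupD[OF assms] by (intro unitary_groupI) auto

lemma mult_in_unitary_group:
  assumes A: "A \<in> carrier (unitary_group n)" and B: "B \<in> carrier (unitary_group n)"
  shows "A * B \<in> carrier (unitary_group n)"
proof (rule unitary_groupI)
  note a = unitary_groupD[OF A] and b = unitary_groupD[OF B]
  note ca = mat_adjoint_carrier[OF a(1)] and cb = mat_adjoint_carrier[OF b(1)]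
  show "A * B \<in> carrier_mat n n" using a b by auto
  have "mat_adjoint (A * B) * (A * B) = mat_adjoint B * ((mat_adjoint A * A) * B)"
    using a(1) b(1) ca cb
    by (simp add: mat_adjoint_mult assoc_mult_mat[of _ n n _ n _ n])
  then show "mat_adjoint (A * B) * (A * B) = 1\<^sub>m n" using a b by simp
qed

lemma group_unitary_group: "group (unitary_group n)"
proof (rule groupI)
  show "\<one>\<^bsub>unitary_group n\<^esub> \<in> carrier (unitary_group n)"
    by (auto intro!: unitary_groupI)
  show "A \<otimes>\<^bsub>unitary_group n\<^esub> B \<in> carrier (unitary_group n)"
    if "A \<in> carrier (unitary_group n)" "B \<in> carrier (unitary_group n)" for A B
    using mult_in_unitary_group[OF that] by simp
  show "A \<otimes>\<^bsub>unitary_group n\<^esub> B \<otimes>\<^bsub>unitary_group n\<^esub> C = A \<otimes>\<^bsub>unitary_group n\<^esub> (B \<otimes>\<^bsub>unitary_group n\<^esub> C)"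
    if "A \<in> carrier (unitary_group n)" "B \<in> carrier (unitary_group n)"
      "C \<in> carrier (unitary_group n)" for A B C
    using that[THEN unitary_groupD(1)] by (simp add: assoc_mult_mat)
  show "\<one>\<^bsub>unitary_group n\<^esub> \<otimes>\<^bsub>unitary_group n\<^esub> A = A" if "A \<in> carrier (unitary_group n)" for A
    using unitary_groupD(1)[OF that] by simp
  show "\<exists>B\<in>carrier (unitary_group n). B \<otimes>\<^bsub>unitary_group n\<^esub> A = \<one>\<^bsub>unitary_group n\<^esub>"
    if "A \<in> carrier (unitary_group n)" for A
    using adjoint_in_unitary_group[OF that] unitary_groupD(2)[OF that] by auto
qed

lemma inv_unitary_group:
  assumes "A \<in> carrier (unitary_group n)"
  shows "inv\<^bsub>unitary_group n\<^esub> A = mat_adjoint A"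
  using adjoint_in_unitary_group[OF assms] unitary_groupD(2)[OF assms] assms
  by (intro group.inv_equality[OF group_unitary_group]) simp_all

lemma cis_smult_in_unitary_group:
  assumes "A \<in> carrier (unitary_group n)"
  shows "cis r \<cdot>\<^sub>m A \<in> carrier (unitary_group n)"
proof (rule unitary_groupI)
  note a = unitary_groupD[OF assms]
  note ca = mat_adjoint_carrier[OF a(1)]
  show "cis r \<cdot>\<^sub>m A \<in> carrier_mat n n" using a by simp
  have "mat_adjoint (cis r \<cdot>\<^sub>m A) = cis (- r) \<cdot>\<^sub>m mat_adjoint A"
    by (rule eq_matI) (auto simp: cis_cnj)
  then have "mat_adjoint (cis r \<cdot>\<^sub>m A) * (cis r \<cdot>\<^sub>m A) = (cis (- r) * cis r) \<cdot>\<^sub>m 1\<^sub>m n"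
    using a(1) ca a(2)
    by (auto simp: mult_smult_assoc_mat[of _ n n _ n] mult_smult_distrib[of _ n n _ n]
      intro!: eq_matI)
  then show "mat_adjoint (cis r \<cdot>\<^sub>m A) * (cis r \<cdot>\<^sub>m A) = 1\<^sub>m n"
    by (simp add: cis_mult) (rule eq_matI; simp)
qed

lemma norm_eigenvalue_unitary:
  assumes A: "A \<in> carrier (unitary_group n)" and "eigenvalue A k"
  shows "cmod k = 1"
proof -
  note a = unitary_groupD[OF A]
  from assms(2) a(1) obtain v where v: "v \<in> carrier_vec n" "v \<noteq> 0\<^sub>v n" "A *\<^sub>v v = k \<cdot>\<^sub>v v"
    unfolding eigenvalue_def eigenvector_def by auto
  have adj: "(A *\<^sub>v v) \<bullet>c w = v \<bullet>c (mat_adjoint A *\<^sub>v w)" if w: "w \<in> carrier_vec n" for w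
  proof -
    have "(A *\<^sub>v v) \<bullet>c w = (\<Sum>i<n. \<Sum>j<n. A $$ (i, j) * v $ j * cnj (w $ i))"
      using a(1) v(1) w
      by (auto simp: scalar_prod_def sum_distrib_right atLeast0LessThan intro!: sum.cong)
    also have "\<dots> = (\<Sum>j<n. \<Sum>i<n. A $$ (i, j) * v $ j * cnj (w $ i))"
      by (rule sum.swap)
    also have "\<dots> = v \<bullet>c (mat_adjoint A *\<^sub>v w)"
      using a(1) v(1) w
      by (auto simp: scalar_prod_def sum_distrib_left atLeast0LessThan cnj_sum mult_ac
          intro!: sum.cong)
    finally show ?thesis .
  qed
  have "(k * cnj k) * (v \<bullet>c v) = (A *\<^sub>v v) \<bullet>c (A *\<^sub>v v)"
    using v by (simp add: conjugate_smult_vec)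
  also have "\<dots> = v \<bullet>c ((mat_adjoint A * A) *\<^sub>v v)"
    using a(1) v(1) by (subst adj) (auto simp: assoc_mult_mat_vec[of _ n n _ n])
  also have "\<dots> = v \<bullet>c v" using a v by simp
  finally have "k * cnj k = 1"
    using v conjugate_square_eq_0_vec[of v n] by auto
  then show ?thesis
    by (metis complex_mod_cnj mult_cancel_left1 norm_ge_zero norm_mult norm_one
      power2_eq_1_iff power2_eq_square abs_norm_cancel abs_1 real_sqrt_abs real_sqrt_one)
qed

lemma eigenangles_eq_iff:
  assumes A: "A \<in> carrier (unitary_group n)"
  shows "eigenangles A = ts \<longleftrightarrow>
    char_poly A = (\<Prod>a\<leftarrow>ts. [:- cis a, 1:]) \<and> sorted_wrt (\<ge>) ts \<and> set ts \<subseteq> {-pi<..pi}"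
    (is "?L \<longleftrightarrow> ?R")
proof -
  note a = unitary_groupD[OF A]
  let ?P = "proots (char_poly A)"
  have monic: "lead_coeff (char_poly A) = 1" and nz: "char_poly A \<noteq> 0"
    using degree_monic_char_poly[OF a(1)] by auto
  have norm1: "cmod z = 1" if "z \<in># ?P" for z
    using that nz norm_eigenvalue_unitary[OF A] eigenvalue_root_char_poly[OF a(1)] by auto
  have cisArg: "cis (Arg z) = z" if "z \<in># ?P" for z
    using norm1[OF that] cis_Arg[of z] by (cases "z = 0") (auto simp: sgn_eq)
  have cis_roots: "image_mset cis (image_mset Arg ?P) = ?P"
    using cisArg by (simp add: image_mset.compositionality comp_def cong: image_mset_cong)
  have decomp: "char_poly A = (\<Prod>x\<in>#?P. [:- x, 1:])"
    using complex_poly_decompose_multiset[of "char_poly A"] monic by simp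
  have prod: "(\<Prod>a\<leftarrow>ts. [:- cis a, 1:]) = (\<Prod>x\<in>#image_mset cis (mset ts). [:- x, 1:])" for ts
    by (simp add: image_mset.compositionality comp_def flip: prod_mset_prod_list)
  have sorted: "sorted_wrt (\<ge>) (rev xs) \<longleftrightarrow> sorted xs" for xs :: "real list"
    by (simp add: sorted_wrt_rev)
  show ?thesis
  proof
    assume L: ?L
    have "mset ts = image_mset Arg ?P"
      unfolding L[symmetric] eigenangles_def by simp
    moreover from this have "set ts = Arg ` set_mset ?P"
      by (metis set_image_mset set_mset_mset)
    moreover have "sorted_wrt (\<ge>) ts"
      unfolding L[symmetric] eigenangles_def sorted by simp
    ultimately show ?R
      using prod[of ts] cis_roots decomp Arg_bounded by auto
  next
    assume R: ?R
    have "(\<Prod>a\<leftarrow>ts. [:- cis a, 1:]) \<noteq> 0" for ts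
      by (induction ts) (simp_all del: mult_pCons_left)
    then have "proots (\<Prod>a\<leftarrow>ts. [:- cis a, 1:]) = image_mset cis (mset ts)" for ts
      by (induction ts) (simp_all add: proots_mult del: mult_pCons_left)
    then have "?P = image_mset cis (mset ts)" using R by simp
    then have "image_mset Arg ?P = image_mset (\<lambda>a. Arg (cis a)) (mset ts)"
      by (simp add: image_mset.compositionality comp_def)
    also have "\<dots> = image_mset (\<lambda>a. a) (mset ts)"
      using R by (intro image_mset_cong cis_Arg_unique) (auto simp: sgn_eq)
    finally have "image_mset Arg ?P = mset (rev ts)" by simp
    moreover have "sorted (rev ts)" using R sorted[of "rev ts"] by simp
    ultimately show ?L
      unfolding eigenangles_def
      by (simp only: sorted_list_of_multiset_mset sorted_sort_id rev_rev_ident)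
  qed
qed

lemma length_eigenangles:
  assumes "A \<in> carrier (unitary_group n)" shows "length (eigenangles A) = n"
proof -
  have "mset (eigenangles A) = image_mset Arg (proots (char_poly A))"
    by (simp add: eigenangles_def)
  then have "length (eigenangles A) = size (image_mset Arg (proots (char_poly A)))"
    by (metis size_mset)
  then show ?thesis
    using degree_monic_char_poly[OF unitary_groupD(1)[OF assms]]
    by (simp add: size_proots_complex)
qed

end

theory Submission
  imports Defs "HOL-Analysis.Convex"
begin

text \<open>Only the triangle inequality for \<open>d\<^sub>g\<close> is deep. Let \<open>U' = U E\<close> where \<open>U\<close>, \<open>E\<close>, \<open>U'\<close> are
  unitary with eigenangles \<open>a\<close>, \<open>h b\<close>, \<open>c\<close>. For a unit eigenvector \<open>x\<close> of \<open>U'\<close> with angle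
  \<open>c\<^sub>j\<close>, the spectral measures \<open>p\<close>, \<open>q\<close> of \<open>U\<close>, \<open>E\<close> at \<open>x\<close> satisfy
  \<open>\<Sum> p\<^sub>l cis a\<^sub>l = cis c\<^sub>j (\<Sum> q\<^sub>l cis (- h b\<^sub>l))\<close>, so \<open>p\<close> has variance of order \<open>h\<^sup>2\<close>
  around \<open>cis c\<^sub>j\<close>. The function \<open>arccos (\<rho> cos t)\<close>, \<open>0 < \<rho> < 1\<close>, smooths away the kinks of
  the distance to \<open>0\<close> on the circle and is \<open>1\<close>-Lipschitz there. Hence its value at \<open>c\<^sub>j\<close> is at most
  its \<open>p\<close>-average over \<open>a\<close>, plus \<open>h\<close> times the \<open>q\<close>-average of \<open>\<bar>b\<bar>\<close>, plus \<open>O(h\<^sup>2)\<close>. The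
  weights form doubly stochastic matrices, so summing over \<open>k\<close> eigenvectors replaces averages by
  sums of the \<open>k\<close> largest values. Iterating \<open>m\<close> steps of size \<open>h = 1/m\<close>, letting \<open>m\<close> tend to
  infinity and then \<open>\<rho>\<close> to \<open>1\<close>, the absolute eigenangles of \<open>A B\<close> are weakly majorized by the
  sum of those of \<open>A\<close> and \<open>B\<close> in decreasing order, and symmetric norms respect weak
  majorization.\<close>

unbundle no vec_syntax

section \<open>Symmetric norms and majorization\<close>

context symmetric_norm
begin

abbreviation gv :: "(nat \<Rightarrow> real) \<Rightarrow> real" where
  "gv f \<equiv> g (vec n f)"

lemma gv_cong: "(\<And>i. i < n \<Longrightarrow> f i = f' i) \<Longrightarrow> gv f = gv f'"
  by (rule arg_cong[of _ _ g]) auto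

lemma gv_add_le: "gv (\<lambda>i. f i + f' i) \<le> gv f + gv f'"
proof -
  have "vec n (\<lambda>i. f i + f' i) = vec n f + vec n f'" by auto
  then show ?thesis using triangle[of "vec n f" "vec n f'"] by simp
qed

lemma gv_scale: "gv (\<lambda>i. c * f i) = \<bar>c\<bar> * gv f"
proof -
  have "vec n (\<lambda>i. c * f i) = c \<cdot>\<^sub>v vec n f" by auto
  then show ?thesis using smult[of "vec n f" c] by simp
qed

text \<open>Sublevel sets of a norm are convex. Used with \<open>f'\<close> a reflection or a swap
  of \<open>f\<close>, which has the same norm.\<close>

lemma gv_convex:
  assumes "0 \<le> t" "t \<le> 1" "gv f' \<le> gv f"
  shows "gv (\<lambda>i. (1 - t) * f i + t * f' i) \<le> gv f"
proof -
  have "gv (\<lambda>i. (1 - t) * f i + t * f' i) \<le> (1 - t) * gv f + t * gv f'"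
    using gv_add_le[of "\<lambda>i. (1 - t) * f i" "\<lambda>i. t * f' i"] assms by (simp add: gv_scale)
  also have "\<dots> \<le> (1 - t) * gv f + t * gv f"
    using assms by (intro add_mono mult_left_mono) auto
  finally show ?thesis by (simp add: algebra_simps)
qed

lemma gv_permute:
  assumes p: "p permutes {..<n}"
  shows "gv (\<lambda>i. f (p i)) = gv f"
proof -
  \<comment> \<open>The inverse permutation appears because invariance is stated through the
    transpose of \<open>?P\<close>.\<close>
  let ?P = "mat n n (\<lambda>(i, j). if j = (inv_into UNIV p) i then 1 else 0) :: real mat"
  have P: "permutation_mat n ?P"
    unfolding permutation_mat_def using permutes_inv[OF p] by blast
  have "transpose_mat ?P *\<^sub>v vec n f = vec n (\<lambda>i. f (p i))"
  proof (rule eq_vecI)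
    fix i assume "i < dim_vec (vec n (\<lambda>i. f (p i)))"
    then have i: "i < n" by simp
    then have pi: "p i < n" using permutes_in_image[OF p] by auto
    have "(transpose_mat ?P *\<^sub>v vec n f) $ i = (\<Sum>j<n. (if i = inv_into UNIV p j then 1 else 0) * f j)"
      using i by (auto simp: scalar_prod_def atLeast0LessThan intro!: sum.cong)
    also have "\<dots> = (\<Sum>j<n. if j = p i then f j else 0)"
      by (intro sum.cong) (auto simp: permutes_inverses[OF p])
    also have "\<dots> = f (p i)" using pi by simp
    finally show "(transpose_mat ?P *\<^sub>v vec n f) $ i = vec n (\<lambda>i. f (p i)) $ i"
      using i by simp
  qed simp
  then show ?thesis using invariant[of "vec n f" ?P] P by simp
qed

lemma gv_sign:
  assumes s: "\<And>i. s i = 1 \<or> s i = -1"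
  shows "gv (\<lambda>i. s i * f i) = gv f"
proof -
  let ?P = "mat n n (\<lambda>(i, j). if i = j then s i else 0)"
  have ss: "s i * s i = 1" for i using s[of i] by auto
  have "?P * transpose_mat ?P = 1\<^sub>m n"
  proof (rule eq_matI)
    fix i j assume "i < dim_row (1\<^sub>m n :: real mat)" "j < dim_col (1\<^sub>m n :: real mat)"
    then have ij: "i < n" "j < n" by auto
    have "(?P * transpose_mat ?P) $$ (i, j)
        = (\<Sum>k<n. (if i = k then s i else 0) * (if j = k then s j else 0))"
      using ij by (auto simp: scalar_prod_def atLeast0LessThan intro!: sum.cong)
    also have "\<dots> = (\<Sum>k<n. if k = i then (if j = i then 1 else 0) else 0)"
      by (intro sum.cong) (auto simp: ss)
    also have "\<dots> = (1\<^sub>m n :: real mat) $$ (i, j)" using ij by auto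
    finally show "(?P * transpose_mat ?P) $$ (i, j) = (1\<^sub>m n :: real mat) $$ (i, j)" .
  qed auto
  then have P: "diagonal_orthogonal_mat n ?P"
    by (auto simp: diagonal_orthogonal_mat_def diagonal_mat_def)
  have "transpose_mat ?P *\<^sub>v vec n f = vec n (\<lambda>i. s i * f i)"
  proof (rule eq_vecI)
    fix i assume "i < dim_vec (vec n (\<lambda>i. s i * f i))"
    then have i: "i < n" by simp
    have "(transpose_mat ?P *\<^sub>v vec n f) $ i = (\<Sum>j<n. (if j = i then s j else 0) * f j)"
      using i by (auto simp: scalar_prod_def atLeast0LessThan intro!: sum.cong)
    also have "\<dots> = (\<Sum>j<n. if j = i then s i * f i else 0)"
      by (intro sum.cong) auto
    also have "\<dots> = s i * f i" using i by simp
    finally show "(transpose_mat ?P *\<^sub>v vec n f) $ i = vec n (\<lambda>i. s i * f i) $ i"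
      using i by simp
  qed simp
  then show ?thesis using invariant[of "vec n f" ?P] P by simp
qed

text \<open>The shrunken vector lies on the segment between \<open>f\<close> and its reflection in
  coordinate \<open>k\<close>, with weight \<open>(1 - t) / 2\<close> on the reflection.\<close>

lemma gv_scale_coordinate:
  assumes "0 \<le> t" "t \<le> 1"
  shows "gv (f(k := t * f k)) \<le> gv f"
proof -
  let ?f' = "\<lambda>i. (if i = k then -1 else 1) * f i"
  have "gv (\<lambda>i. (1 - (1 - t) / 2) * f i + (1 - t) / 2 * ?f' i) \<le> gv f"
    using assms gv_sign[of "\<lambda>i. if i = k then -1 else 1" f] by (intro gv_convex) auto
  also have "(\<lambda>i. (1 - (1 - t) / 2) * f i + (1 - t) / 2 * ?f' i) = f(k := t * f k)"
    by (auto simp: field_simps)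
  finally show ?thesis .
qed

text \<open>Passing from \<open>x\<close> to \<open>y\<close> one coordinate at a time, each change
  multiplies a single coordinate by a factor in \<open>[0, 1]\<close>.\<close>

lemma gv_mono:
  assumes "\<And>i. i < n \<Longrightarrow> 0 \<le> y i" "\<And>i. i < n \<Longrightarrow> y i \<le> x i"
  shows "gv y \<le> gv x"
proof -
  have "gv (\<lambda>i. if i < k then y i else x i) \<le> gv x" if "k \<le> n" for k
    using that
  proof (induction k)
    case (Suc k)
    let ?f = "\<lambda>i. if i < k then y i else x i"
    \<comment> \<open>If \<open>x k = 0\<close> then \<open>y k = 0\<close> as well, so the factor 0
      is correct there.\<close>
    define t where "t = (if x k = 0 then 0 else y k / x k)"
    have "0 \<le> y k" "y k \<le> x k" using assms[of k] Suc.prems by auto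
    then have t: "0 \<le> t" "t \<le> 1" "y k = t * x k" by (auto simp: t_def)
    have "(\<lambda>i. if i < Suc k then y i else x i) = ?f(k := t * ?f k)"
      using t(3) by (auto simp: less_Suc_eq)
    then have "gv (\<lambda>i. if i < Suc k then y i else x i) \<le> gv ?f"
      using gv_scale_coordinate[OF t(1,2), of ?f k] by simp
    also have "\<dots> \<le> gv x" using Suc by simp
    finally show ?case .
  qed simp
  from this[of n] show ?thesis by (simp cong: gv_cong)
qed

text \<open>Moving the amount \<open>d\<close> from coordinate \<open>i\<close> to coordinate
  \<open>k\<close> is a convex combination of \<open>x\<close> and \<open>x\<close> with these two
  coordinates swapped.\<close>

lemma gv_transfer:
  assumes ik: "i < n" "k < n" "i \<noteq> k" and d: "0 \<le> d" "d \<le> x i - x k"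
  shows "gv (x(i := x i - d, k := x k + d)) \<le> gv x"
proof (cases "d = 0")
  case False
  define t where "t = d / (x i - x k)"
  have pos: "0 < x i - x k" using d False by linarith
  have t: "0 \<le> t" "t \<le> 1" "t * (x i - x k) = d"
    using d pos by (auto simp: t_def)
  let ?x' = "\<lambda>j. x (Transposition.transpose i k j)"
  have "gv (\<lambda>j. (1 - t) * x j + t * ?x' j) \<le> gv x"
    using t ik by (intro gv_convex) (auto simp: gv_permute permutes_swap_id)
  also have "(\<lambda>j. (1 - t) * x j + t * ?x' j) = x(i := x i - d, k := x k + d)"
    using ik(3) unfolding t(3)[symmetric]
    by (auto simp: Transposition.transpose_def algebra_simps)
  finally show ?thesis .
qed simp

text \<open>The Hardy--Littlewood--Polya argument: each transfer makes one more coordinate of \<open>x\<close>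
  agree with \<open>y\<close> and keeps the domination of the partial sums.\<close>

lemma gv_le_of_weak_majorization:
  assumes "\<And>i. i < n \<Longrightarrow> 0 \<le> y i"
    and "\<And>i j. i \<le> j \<Longrightarrow> j < n \<Longrightarrow> y j \<le> y i"
    and "\<And>m. m \<le> n \<Longrightarrow> (\<Sum>i<m. y i) \<le> (\<Sum>i<m. x i)"
  shows "gv y \<le> gv x"
  using assms(3)
proof (induction "card {i. i < n \<and> x i \<noteq> y i}" arbitrary: x rule: less_induct)
  case less
  note IH = less.hyps and prems = less.prems
  show ?case
  proof (cases "\<forall>i<n. y i \<le> x i")
    case True
    then show ?thesis using assms(1) by (intro gv_mono) auto
  next
    case False
    \<comment> \<open>The first index at which \<open>x\<close> falls short of \<open>y\<close>.
      Domination of the partial sums up to and including \<open>k\<close> forces a surplus at some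
      earlier index.\<close>
    define k where "k = (LEAST k. k < n \<and> x k < y k)"
    have "\<exists>k. k < n \<and> x k < y k" using False by (auto simp: not_le)
    then have k: "k < n" "x k < y k" unfolding k_def by (metis (mono_tags, lifting) LeastI)+
    have below_k: "y j \<le> x j" if "j < k" for j
      using not_less_Least[OF that[unfolded k_def]] that k by auto
    have "\<exists>i<k. y i < x i"
    proof (rule ccontr)
      assume "\<not> ?thesis"
      then have "(\<Sum>i<k. x i) \<le> (\<Sum>i<k. y i)" by (intro sum_mono) force
      then show False using prems[of "Suc k"] k by simp
    qed
    then obtain i where i: "i < k" "y i < x i" by blast
    \<comment> \<open>The largest transfer that overshoots at neither index; one of the two
      coordinates then agrees with \<open>y\<close>. Since \<open>y k \<le> y i\<close>, it does not
      exceed \<open>x i - x k\<close>.\<close>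
    define d where "d = min (x i - y i) (y k - x k)"
    have d: "0 < d" "d \<le> x i - y i" "d \<le> y k - x k" "d = x i - y i \<or> d = y k - x k"
      using i k unfolding d_def by auto
    have yik: "y k \<le> y i" using assms(2) i k by auto
    let ?x' = "x(i := x i - d, k := x k + d)"
    have i_n: "i < n" using i k by simp
    have ik: "i \<noteq> k" "0 \<le> d" "d \<le> x i - x k" using d yik i k by linarith+
    have "gv ?x' \<le> gv x" by (fact gv_transfer[of i k d x, OF i_n k(1) ik])
    moreover have "gv y \<le> gv ?x'"
    proof (rule IH[of ?x'])
      have "{j. j < n \<and> ?x' j \<noteq> y j} \<subseteq> {j. j < n \<and> x j \<noteq> y j}"
        using i(2) k(2) by (intro Collect_mono) (simp add: less_imp_neq less_imp_neq[THEN not_sym])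
      moreover have "\<exists>j. j < n \<and> x j \<noteq> y j \<and> ?x' j = y j"
        using d(4)
      proof
        assume "d = x i - y i"
        then show ?thesis using i(2) i_n ik(1) by (intro exI[of _ i]) simp
      next
        assume "d = y k - x k"
        then show ?thesis using k by (intro exI[of _ k]) simp
      qed
      ultimately have "{j. j < n \<and> ?x' j \<noteq> y j} \<subset> {j. j < n \<and> x j \<noteq> y j}" by blast
      then show "card {j. j < n \<and> ?x' j \<noteq> y j} < card {j. j < n \<and> x j \<noteq> y j}"
        by (intro psubset_card_mono) auto
    next
      fix m assume m: "m \<le> n"
      have upd: "(\<Sum>j<m. ?x' j)
          = (\<Sum>j<m. x j) - (if i < m then d else 0) + (if k < m then d else 0)"
      proof -
        have "(\<Sum>j<m. ?x' j)
          = (\<Sum>j<m. x j + ((if j = i then - d else 0) + (if j = k then d else 0)))"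
          using i by (intro sum.cong) auto
        then show ?thesis by (simp add: sum.distrib)
      qed
      \<comment> \<open>Only the partial sums with \<open>i < m \<le> k\<close> change. In that
        range every summand of the new vector is still at least that of \<open>y\<close>, because
        \<open>k\<close> was the first deficient index.\<close>
      show "(\<Sum>j<m. y j) \<le> (\<Sum>j<m. ?x' j)"
      proof (cases "i < m \<and> m \<le> k")
        case True
        have "y j \<le> ?x' j" if "j < m" for j
          using below_k[of j] d(2) that True by simp
        then show ?thesis by (intro sum_mono) auto
      next
        case False
        then have "(\<Sum>j<m. ?x' j) = (\<Sum>j<m. x j)" using i by (subst upd) auto
        then show ?thesis using prems[OF m] by simp
      qed
    qed
    ultimately show ?thesis by simp
  qed
qed

end

text \<open>Weights in \<open>[0, 1]\<close> of total \<open>k\<close> do best when they are all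
  placed on the \<open>k\<close> largest values.\<close>

lemma weighted_sum_le_partial_sum:
  fixes q u :: "nat \<Rightarrow> real"
  assumes q: "\<And>l. l < n \<Longrightarrow> 0 \<le> q l" "\<And>l. l < n \<Longrightarrow> q l \<le> 1" "(\<Sum>l<n. q l) = real k"
    and u: "\<And>i j. i \<le> j \<Longrightarrow> j < n \<Longrightarrow> u j \<le> u i" and k: "k \<le> n"
  shows "(\<Sum>l<n. q l * u l) \<le> (\<Sum>l<k. u l)"
proof (cases k)
  case 0
  then have "q l = 0" if "l < n" for l
    using q that sum_nonneg_eq_0_iff[of "{..<n}" q] by auto
  then show ?thesis using 0 by simp
next
  case (Suc k')
  have ind: "(\<Sum>l<n. if l < k then f l else (0 :: real)) = (\<Sum>l<k. f l)" for f
  proof -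
    have "{..<n} \<inter> {l. l < k} = {..<k}" using k by auto
    then show ?thesis by (simp add: sum.If_cases)
  qed
  have "(\<Sum>l<n. q l * u l) - (\<Sum>l<k. u l) = (\<Sum>l<n. (q l - (if l < k then 1 else 0)) * u l)"
    by (subst ind[symmetric], subst sum_subtractf[symmetric]) (auto intro!: sum.cong simp: algebra_simps)
  \<comment> \<open>The weight difference is nonpositive for \<open>l < k\<close> and nonnegative
    afterwards, so each \<open>u l\<close> may be replaced by the threshold \<open>u k'\<close>. The
    differences sum to 0.\<close>
  also have "\<dots> \<le> (\<Sum>l<n. (q l - (if l < k then 1 else 0)) * u k')"
  proof (rule sum_mono)
    fix l assume l: "l \<in> {..<n}"
    show "(q l - (if l < k then 1 else 0)) * u l \<le> (q l - (if l < k then 1 else 0)) * u k'"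
    proof (cases "l < k")
      case True
      then have "u k' \<le> u l" using u[of l k'] Suc k by auto
      then show ?thesis using True l q(2)[of l] by (auto intro!: mult_left_mono_neg)
    next
      case False
      then have "u l \<le> u k'" using u[of k' l] Suc l by auto
      then show ?thesis using False l q(1)[of l] by (auto intro!: mult_left_mono)
    qed
  qed
  also have "\<dots> = 0"
    using ind[of "\<lambda>_. 1"] q(3) by (simp add: sum_distrib_right[symmetric] sum_subtractf)
  finally show ?thesis by simp
qed

section \<open>The smoothed distance on the circle\<close>

text \<open>The function \<open>arccos (\<rho> * u)\<close> is not convex, but for
  \<open>\<rho> < 1\<close> its second derivative is bounded on \<open>[-1, 1]\<close>. It therefore
  stays above each tangent up to a quadratic error with a uniform constant.\<close>

lemma arccos_scaled_tangent:
  fixes \<rho> :: real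
  assumes \<rho>: "0 < \<rho>" "\<rho> < 1"
  obtains C where "0 \<le> C"
    "\<And>u v. \<bar>u\<bar> \<le> 1 \<Longrightarrow> \<bar>v\<bar> \<le> 1 \<Longrightarrow>
      arccos (\<rho> * u) - \<rho> / sqrt (1 - (\<rho> * u)\<^sup>2) * (v - u) - C * (v - u)\<^sup>2 \<le> arccos (\<rho> * v)"
proof -
  \<comment> \<open>\<open>C\<close> is chosen such that \<open>arccos (\<rho> u) + C u\<^sup>2\<close> is convex on \<open>[-1, 1]\<close>.\<close>
  define D where "D = (sqrt (1 - \<rho>\<^sup>2)) ^ 3"
  define C where "C = 1 / (2 * D)"
  have \<rho>2: "\<rho>\<^sup>2 < 1" using \<rho> by (simp add: power_less_one_iff)
  then have D: "0 < D" unfolding D_def by simp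
  then have C: "0 < C" unfolding C_def by simp
  let ?f = "\<lambda>u. arccos (\<rho> * u) + C * u\<^sup>2"
  let ?f' = "\<lambda>u. - \<rho> / sqrt (1 - (\<rho> * u)\<^sup>2) + 2 * C * u"
  let ?f'' = "\<lambda>u. - (\<rho> ^ 3) * u / (sqrt (1 - (\<rho> * u)\<^sup>2)) ^ 3 + 2 * C"
  have small: "(\<rho> * u)\<^sup>2 \<le> \<rho>\<^sup>2" "\<bar>\<rho> * u\<bar> < 1" if "u \<in> {-1..1}" for u
  proof -
    have u: "\<bar>u\<bar> \<le> 1" using that by auto
    then have "\<bar>\<rho> * u\<bar> \<le> \<rho>" using \<rho> mult_left_mono[OF u, of \<rho>] by (simp add: abs_mult)
    then show "(\<rho> * u)\<^sup>2 \<le> \<rho>\<^sup>2" "\<bar>\<rho> * u\<bar> < 1"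
      using \<rho> by (auto simp: abs_le_square_iff[symmetric])
  qed
  have f': "(?f has_real_derivative ?f' u) (at u)" if "u \<in> {-1..1}" for u
    using small[OF that]
    by (auto intro!: derivative_eq_intros simp: field_simps)
  have f'': "(?f' has_real_derivative ?f'' u) (at u)" if "u \<in> {-1..1}" for u
  proof -
    have pos: "0 < 1 - (\<rho> * u)\<^sup>2" using small[OF that] \<rho>2 by simp
    define w where "w = sqrt (1 - (\<rho> * u)\<^sup>2)"
    have w: "0 < w" using pos unfolding w_def by simp
    have dw: "((\<lambda>u. sqrt (1 - (\<rho> * u)\<^sup>2)) has_real_derivative - (\<rho>\<^sup>2 * u) / w) (at u)"
      using pos unfolding w_def
      by (auto intro!: derivative_eq_intros simp: field_simps power2_eq_square)
    have "((\<lambda>u. - \<rho> / sqrt (1 - (\<rho> * u)\<^sup>2)) has_real_derivative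
        (0 * w - (- \<rho>) * (- (\<rho>\<^sup>2 * u) / w)) / (w * w)) (at u)"
      using DERIV_divide[OF DERIV_const dw, of "- \<rho>"] w unfolding w_def by simp
    moreover have "((\<lambda>u. 2 * C * u) has_real_derivative 2 * C) (at u)"
      by (auto intro!: derivative_eq_intros)
    ultimately have "(?f' has_real_derivative
        ((0 * w - (- \<rho>) * (- (\<rho>\<^sup>2 * u) / w)) / (w * w) + 2 * C)) (at u)"
      by (rule DERIV_add)
    also have "(0 * w - (- \<rho>) * (- (\<rho>\<^sup>2 * u) / w)) / (w * w) + 2 * C = ?f'' u"
      unfolding w_def[symmetric] using w
      by (simp add: power2_eq_square power3_eq_cube)
    finally show ?thesis .
  qed
  \<comment> \<open>\<open>D\<close> is the least value of the denominator on
    \<open>[-1, 1]\<close>, so the first term of \<open>?f''\<close> is at least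
    \<open>- 1 / D\<close>, and \<open>2 * C = 1 / D\<close> compensates it.\<close>
  have pos'': "0 \<le> ?f'' u" if "u \<in> {-1..1}" for u
  proof -
    have "D \<le> (sqrt (1 - (\<rho> * u)\<^sup>2)) ^ 3"
      unfolding D_def using small[OF that] \<rho>2 by (intro power_mono) auto
    moreover have "\<rho> ^ 3 * u \<le> 1"
      using that \<rho> power_le_one[of \<rho> 3] mult_mono[of "\<rho>^3" 1 "\<bar>u\<bar>" 1]
      by (smt (verit) atLeastAtMost_iff mult_left_mono mult_cancel_left1 zero_le_power)
    ultimately have "\<rho> ^ 3 * u / (sqrt (1 - (\<rho> * u)\<^sup>2)) ^ 3 \<le> 1 / D"
      using D by (smt (verit) divide_right_mono frac_le)
    then show ?thesis by (simp add: C_def)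
  qed
  have tangent: "?f' u * (v - u) \<le> ?f v - ?f u" if "\<bar>u\<bar> \<le> 1" "\<bar>v\<bar> \<le> 1" for u v
    using that by (intro f''_imp_f'[of "{-1..1}" ?f ?f' ?f'', OF _ f' f'' pos'']) auto
  show thesis
  proof
    show "0 \<le> C" using C by simp
    fix u v :: real assume uv: "\<bar>u\<bar> \<le> 1" "\<bar>v\<bar> \<le> 1"
    show "arccos (\<rho> * u) - \<rho> / sqrt (1 - (\<rho> * u)\<^sup>2) * (v - u) - C * (v - u)\<^sup>2
        \<le> arccos (\<rho> * v)"
      using tangent[OF uv] by (simp add: algebra_simps power2_eq_square)
  qed
qed

lemma one_minus_cos_le: "1 - cos (t :: real) \<le> t\<^sup>2 / 2"
proof -
  have "1 - cos t = 2 * (sin (t / 2))\<^sup>2"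
    using cos_double_sin[of "t / 2"] by simp
  also have "\<dots> \<le> 2 * (t / 2)\<^sup>2"
    using abs_sin_x_le_abs_x[of "t / 2"] by (simp only: abs_le_square_iff)
  finally show ?thesis by (simp add: power2_eq_square)
qed

text \<open>The difference of cosines is at most the chord between \<open>cis (a l)\<close> and
  \<open>cis c\<close>, whose square is \<open>2 * (1 - cos (a l - c))\<close>. The right side is
  the \<open>p\<close>-average of these squares.\<close>

lemma sum_cos_sq_diff_le:
  fixes p a :: "nat \<Rightarrow> real"
  assumes p: "\<And>l. l < n \<Longrightarrow> 0 \<le> p l" "(\<Sum>l<n. p l) = 1"
  shows "(\<Sum>l<n. p l * (cos (a l) - cos c)\<^sup>2)
    \<le> 2 * (1 - Re (cis (- c) * (\<Sum>l<n. of_real (p l) * cis (a l))))"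
proof -
  have "(cos (a l) - cos c)\<^sup>2 \<le> 2 * (1 - cos (a l - c))" for l
  proof -
    have "(cos (a l) - cos c)\<^sup>2 \<le> (cos (a l) - cos c)\<^sup>2 + (sin (a l) - sin c)\<^sup>2" by simp
    also have "\<dots> = ((sin (a l))\<^sup>2 + (cos (a l))\<^sup>2) + ((sin c)\<^sup>2 + (cos c)\<^sup>2) - 2 * cos (a l - c)"
      by (simp add: cos_diff power2_eq_square algebra_simps)
    finally show ?thesis by simp
  qed
  then have "(\<Sum>l<n. p l * (cos (a l) - cos c)\<^sup>2) \<le> (\<Sum>l<n. p l * (2 * (1 - cos (a l - c))))"
    using p by (intro sum_mono mult_left_mono) auto
  also have "\<dots> = 2 * (\<Sum>l<n. p l) - 2 * (\<Sum>l<n. p l * cos (a l - c))"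
    by (simp add: sum_subtractf sum_distrib_left algebra_simps)
  also have "(\<Sum>l<n. p l * cos (a l - c)) = Re (cis (- c) * (\<Sum>l<n. of_real (p l) * cis (a l)))"
    by (simp add: sum_distrib_left cos_diff algebra_simps sum.distrib Re_sum)
  finally show ?thesis using p(2) by simp
qed

text \<open>The tangent bound at \<open>u = cos c\<close> is averaged over
  \<open>v = cos (a l)\<close> with weights \<open>p\<close>. By \<open>eq\<close>, the mean
  displacement has a first-order part controlled by the \<open>q\<close>-average of the
  \<open>\<bar>b l\<bar>\<close>; the rest of it and the variance are of order
  \<open>h^2\<close>.\<close>

lemma arccos_scaled_step:
  fixes p q a b :: "nat \<Rightarrow> real"
  assumes \<rho>: "0 < \<rho>" "\<rho> < 1" and C: "0 \<le> C"
    and tangent: "\<And>u v. \<bar>u\<bar> \<le> 1 \<Longrightarrow> \<bar>v\<bar> \<le> 1 \<Longrightarrow>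
      arccos (\<rho> * u) - \<rho> / sqrt (1 - (\<rho> * u)\<^sup>2) * (v - u) - C * (v - u)\<^sup>2 \<le> arccos (\<rho> * v)"
    and p: "\<And>l. l < n \<Longrightarrow> 0 \<le> p l" "(\<Sum>l<n. p l) = 1"
    and q: "\<And>l. l < n \<Longrightarrow> 0 \<le> q l" "(\<Sum>l<n. q l) = 1"
    and b: "\<And>l. l < n \<Longrightarrow> \<bar>b l\<bar> \<le> pi" and h: "0 \<le> h"
    and eq: "(\<Sum>l<n. of_real (p l) * cis (a l))
      = cis c * (\<Sum>l<n. of_real (q l) * cis (- (h * b l)))"
  shows "arccos (\<rho> * cos c) \<le> (\<Sum>l<n. p l * arccos (\<rho> * cos (a l)))
    + h * (\<Sum>l<n. q l * \<bar>b l\<bar>) + (C + 1 / sqrt (1 - \<rho>\<^sup>2)) * pi\<^sup>2 * h\<^sup>2"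
proof -
  \<comment> \<open>Minus the slope of \<open>arccos (\<rho> * u)\<close> at
    \<open>u = cos c\<close>.\<close>
  define K where "K = \<rho> / sqrt (1 - (\<rho> * cos c)\<^sup>2)"
  \<comment> \<open>The \<open>q\<close>-average of \<open>cis (- (h * b l))\<close> is
    \<open>1 - V - i S\<close>, with \<open>V\<close> of second and \<open>S\<close> of first order
    in \<open>h\<close>.\<close>
  define V where "V = (\<Sum>l<n. q l * (1 - cos (h * b l)))"
  define S where "S = (\<Sum>l<n. q l * sin (h * b l))"
  have \<rho>2: "\<rho>\<^sup>2 < 1" using \<rho> by (simp add: power_less_one_iff)
  have cc: "(\<rho> * cos c)\<^sup>2 \<le> \<rho>\<^sup>2"
    using \<rho> cos_squared_eq[of c] by (simp add: power_mult_distrib mult_left_le)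
  have sqrt_pos: "0 < sqrt (1 - (\<rho> * cos c)\<^sup>2)" using cc \<rho>2 by simp
  have K: "0 \<le> K" "K \<le> 1 / sqrt (1 - \<rho>\<^sup>2)"
    using \<rho> \<rho>2 cc sqrt_pos unfolding K_def by (auto intro!: frac_le)
  \<comment> \<open>\<open>K * sin c\<close> is the derivative of
    \<open>arccos (\<rho> * cos t)\<close> at \<open>t = c\<close>; this is the 1-Lipschitz property
    that gives the first-order term the constant 1.\<close>
  have K_sin: "\<bar>K * sin c\<bar> \<le> 1"
  proof -
    have "(\<rho> * \<bar>sin c\<bar>)\<^sup>2 = \<rho>\<^sup>2 - (\<rho> * cos c)\<^sup>2"
      by (simp add: power_mult_distrib sin_squared_eq algebra_simps)
    also have "\<dots> \<le> 1 - (\<rho> * cos c)\<^sup>2" using \<rho>2 by simp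
    finally have "\<rho> * \<bar>sin c\<bar> \<le> sqrt (1 - (\<rho> * cos c)\<^sup>2)" by (rule real_le_rsqrt)
    then show ?thesis using \<rho> sqrt_pos by (simp add: K_def abs_mult)
  qed
  have V: "0 \<le> V" "V \<le> pi\<^sup>2 * h\<^sup>2 / 2"
  proof -
    show "0 \<le> V" unfolding V_def using q by (auto intro!: sum_nonneg)
    have "1 - cos (h * b l) \<le> pi\<^sup>2 * h\<^sup>2 / 2" if "l < n" for l
    proof -
      have "(b l)\<^sup>2 \<le> pi\<^sup>2" using b[OF that] by (simp add: abs_le_square_iff[symmetric])
      then have "(h * b l)\<^sup>2 \<le> pi\<^sup>2 * h\<^sup>2"
        by (simp add: power_mult_distrib mult.commute[of "pi\<^sup>2"] mult_left_mono)
      then show ?thesis using one_minus_cos_le[of "h * b l"] by simp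
    qed
    then have "V \<le> (\<Sum>l<n. q l * (pi\<^sup>2 * h\<^sup>2 / 2))"
      unfolding V_def using q by (intro sum_mono mult_left_mono) auto
    also have "\<dots> = (\<Sum>l<n. q l) * (pi\<^sup>2 * h\<^sup>2 / 2)" by (rule sum_distrib_right[symmetric])
    finally show "V \<le> pi\<^sup>2 * h\<^sup>2 / 2" using q(2) by simp
  qed
  have S: "\<bar>S\<bar> \<le> h * (\<Sum>l<n. q l * \<bar>b l\<bar>)"
  proof -
    have "\<bar>S\<bar> \<le> (\<Sum>l<n. \<bar>q l * sin (h * b l)\<bar>)" unfolding S_def by (rule sum_abs)
    also have "\<dots> \<le> (\<Sum>l<n. q l * (h * \<bar>b l\<bar>))"
    proof (rule sum_mono)
      fix l assume "l \<in> {..<n}"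
      then have "0 \<le> q l" using q by auto
      then show "\<bar>q l * sin (h * b l)\<bar> \<le> q l * (h * \<bar>b l\<bar>)"
        using abs_sin_x_le_abs_x[of "h * b l"] h by (simp add: abs_mult mult_left_mono)
    qed
    finally show ?thesis by (simp add: sum_distrib_left algebra_simps)
  qed
  have "(\<Sum>l<n. of_real (q l) * cis (- (h * b l))) = Complex (1 - V) (- S)"
    using q(2) unfolding V_def S_def
    by (auto simp: complex_eq_iff Re_sum Im_sum algebra_simps sum_subtractf sum_negf)
  note eq' = eq[unfolded this]
  have drift: "(\<Sum>l<n. p l * (cos (a l) - cos c)) = sin c * S - cos c * V"
    using arg_cong[OF eq', of Re] p(2)
    by (simp add: Re_sum algebra_simps sum_subtractf sum_distrib_left[symmetric])
  have "cis (- c) * (\<Sum>l<n. of_real (p l) * cis (a l)) = Complex (1 - V) (- S)"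
    unfolding eq' by (simp add: mult.assoc[symmetric] cis_mult)
  then have var: "(\<Sum>l<n. p l * (cos (a l) - cos c)\<^sup>2) \<le> 2 * V"
    using sum_cos_sq_diff_le[of n p a c, OF p] by simp
  have "arccos (\<rho> * cos c) - K * (\<Sum>l<n. p l * (cos (a l) - cos c))
      - C * (\<Sum>l<n. p l * (cos (a l) - cos c)\<^sup>2)
    = (\<Sum>l<n. p l * (arccos (\<rho> * cos c) - K * (cos (a l) - cos c) - C * (cos (a l) - cos c)\<^sup>2))"
    using p(2) by (simp add: right_diff_distrib sum_subtractf sum_distrib_left
      sum_distrib_right[symmetric] mult.left_commute[of K] mult.left_commute[of C])
  also have "\<dots> \<le> (\<Sum>l<n. p l * arccos (\<rho> * cos (a l)))"
    unfolding K_def using p by (intro sum_mono mult_left_mono tangent) auto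
  finally have main: "arccos (\<rho> * cos c) \<le> (\<Sum>l<n. p l * arccos (\<rho> * cos (a l)))
      + K * (sin c * S - cos c * V) + C * (\<Sum>l<n. p l * (cos (a l) - cos c)\<^sup>2)"
    unfolding drift by simp
  have "K * (sin c * S) \<le> \<bar>K * sin c\<bar> * \<bar>S\<bar>"
    by (metis abs_ge_self abs_mult mult.assoc)
  also have "\<dots> \<le> 1 * \<bar>S\<bar>" by (intro mult_right_mono K_sin) auto
  finally have 1: "K * (sin c * S) \<le> h * (\<Sum>l<n. q l * \<bar>b l\<bar>)" using S by simp
  \<comment> \<open>The sign of \<open>cos c\<close> is unknown, but \<open>V\<close> is already of
    order \<open>h^2\<close>, so the crude bound goes into the error term.\<close>
  have "- cos c * V \<le> 1 * V"
    using cos_ge_minus_one[of c] V by (intro mult_right_mono) auto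
  then have "K * (- cos c * V) \<le> K * V" using K by (intro mult_left_mono) auto
  also have "\<dots> \<le> 1 / sqrt (1 - \<rho>\<^sup>2) * (pi\<^sup>2 * h\<^sup>2)"
    using K V \<rho>2 by (intro mult_mono) auto
  finally have 2: "K * (- cos c * V) \<le> 1 / sqrt (1 - \<rho>\<^sup>2) * (pi\<^sup>2 * h\<^sup>2)" .
  have 3: "C * (\<Sum>l<n. p l * (cos (a l) - cos c)\<^sup>2) \<le> C * (pi\<^sup>2 * h\<^sup>2)"
    using var V C by (intro mult_left_mono) auto
  show ?thesis using main 1 2 3 by (simp add: algebra_simps)
qed

section \<open>Unitary diagonalization\<close>

lemma mat_adjoint_mat_diag: "mat_adjoint (mat_diag n d) = mat_diag n (\<lambda>i. cnj (d i))"
  by (rule eq_matI) (auto simp: mat_diag_def)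

text \<open>\<open>W\<close> is a Householder reflection. The phase \<open>k\<close> makes the first entry \<open>u 0\<close> of its first
  column a nonpositive real, so that the denominator \<open>s = 1 - u 0\<close> does not vanish.\<close>

lemma unitary_first_column:
  assumes n: "0 < n" and v: "(\<Sum>i<n. v i * cnj (v i)) = 1"
  obtains W k where "W \<in> carrier (unitary_group n)" "k \<noteq> 0" "\<And>i. i < n \<Longrightarrow> W $$ (i, 0) = k * v i"
proof -
  define k where "k = (if v 0 = 0 then 1 else - cnj (v 0) / of_real (cmod (v 0)))"
  define u where "u i = k * v i" for i
  have "cmod k = 1" by (simp add: k_def norm_divide)
  then have k: "k * cnj k = 1" by (simp flip: complex_norm_square)
  have u: "(\<Sum>i<n. u i * cnj (u i)) = 1"
  proof -
    have "(\<Sum>i<n. u i * cnj (u i)) = (k * cnj k) * (\<Sum>i<n. v i * cnj (v i))"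
      by (simp add: u_def sum_distrib_left mult_ac)
    then show ?thesis using k v by simp
  qed
  have u0: "u 0 = of_real (- cmod (v 0))"
  proof (cases "v 0 = 0")
    case False
    have "u 0 = - (v 0 * cnj (v 0)) / of_real (cmod (v 0))"
      using False by (simp add: u_def k_def)
    also have "v 0 * cnj (v 0) = (of_real (cmod (v 0)))\<^sup>2" by (metis complex_norm_square of_real_power)
    finally show ?thesis using False by (simp add: power2_eq_square)
  qed (simp add: u_def)
  define s where "s = 1 + cmod (v 0)"
  have s: "s > 0" unfolding s_def by (simp add: add_pos_nonneg)
  define w where "w i = (if i = 0 then 1 else 0) - u i" for i
  have w0: "w 0 = of_real s" unfolding w_def s_def u0 by simp
  \<comment> \<open>The squared length \<open>2 * s\<close> turns the coefficient 2 over squared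
    length of a reflection into \<open>1 / s\<close>.\<close>
  have ww: "(\<Sum>i<n. w i * cnj (w i)) = 2 * of_real s"
  proof -
    have "(\<Sum>i<n. w i * cnj (w i))
      = (\<Sum>i<n. u i * cnj (u i) + (if i = 0 then 1 - u 0 - cnj (u 0) else 0))"
      by (intro sum.cong) (auto simp: w_def algebra_simps)
    also have "\<dots> = 2 - u 0 - cnj (u 0)" using n u by (simp add: sum.distrib)
    finally show ?thesis by (simp add: u0 s_def)
  qed
  define W where "W = mat n n (\<lambda>(i, j). (if i = j then 1 else 0) - w i * cnj (w j) / of_real s)"
  show thesis
  proof
    show "k \<noteq> 0" using k by auto
    show "W $$ (i, 0) = k * v i" if "i < n" for i
    proof -
      have "w i * cnj (w 0) / of_real s = w i" using s by (simp add: w0)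
      then have "W $$ (i, 0) = (if i = 0 then 1 else 0) - w i" using that n by (simp add: W_def)
      then show ?thesis by (simp add: w_def u_def)
    qed
    show "W \<in> carrier (unitary_group n)"
    proof (rule unitary_groupI)
      show W: "W \<in> carrier_mat n n" by (simp add: W_def)
      show "mat_adjoint W * W = 1\<^sub>m n"
      proof (rule eq_matI)
        fix i j assume "i < dim_row (1\<^sub>m n :: complex mat)" "j < dim_col (1\<^sub>m n :: complex mat)"
        then have ij: "i < n" "j < n" by auto
        have "(mat_adjoint W * W) $$ (i, j) = (\<Sum>l<n. cnj (W $$ (l, i)) * W $$ (l, j))"
          using ij W by (auto simp: scalar_prod_def atLeast0LessThan intro!: sum.cong)
        also have "\<dots> = (\<Sum>l<n. (if l = i then (if i = j then 1 else 0) - w i * cnj (w j) / of_real s else 0)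
            + (if l = j then - w i * cnj (w j) / of_real s else 0)
            + w i * cnj (w j) / (of_real s)\<^sup>2 * (w l * cnj (w l)))"
          using ij by (intro sum.cong) (auto simp: W_def power2_eq_square divide_inverse algebra_simps)
        also have "\<dots> = (if i = j then 1 else 0) - 2 * w i * cnj (w j) / of_real s
            + w i * cnj (w j) / (of_real s)\<^sup>2 * (2 * of_real s)"
          unfolding sum.distrib sum_distrib_left[symmetric] ww using ij by simp
        also have "\<dots> = (1\<^sub>m n :: complex mat) $$ (i, j)"
          using ij s by (simp add: power2_eq_square)
        finally show "(mat_adjoint W * W) $$ (i, j) = (1\<^sub>m n :: complex mat) $$ (i, j)" .
      qed (use W in auto)
    qed
  qed
qed

section \<open>Deflation and diagonalization by block matrices\<close>

definition cons_block :: "nat \<Rightarrow> complex \<Rightarrow> complex mat \<Rightarrow> complex mat" where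
  "cons_block m a B = four_block_mat (mat_diag 1 (\<lambda>_. a)) (0\<^sub>m 1 m) (0\<^sub>m m 1) B"

lemma cons_block_carrier: "B \<in> carrier_mat m m \<Longrightarrow> cons_block m a B \<in> carrier_mat (Suc m) (Suc m)"
  unfolding cons_block_def
  by (rule carrier_matI) (auto simp: mat_diag_def)

lemma cons_block_mult:
  assumes "B \<in> carrier_mat m m" "D \<in> carrier_mat m m"
  shows "cons_block m a B * cons_block m c D = cons_block m (a * c) (B * D)"
  unfolding cons_block_def
  by (subst mult_four_block_mat[of _ 1 1 _ m _ m _ _ 1 _ m]) (use assms in
      \<open>auto simp: right_mult_zero_mat[of _ "Suc 0"] left_mult_zero_mat[of _ "Suc 0" "Suc 0"]\<close>)

lemma cons_block_adjoint:
  assumes "B \<in> carrier_mat m m"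
  shows "mat_adjoint (cons_block m a B) = cons_block m (cnj a) (mat_adjoint B)"
  by (rule eq_matI) (use assms in \<open>auto simp: cons_block_def mat_diag_def four_block_mat_def Let_def\<close>)

lemma cons_block_mat_diag:
  "cons_block m a (mat_diag m d) = mat_diag (Suc m) (case_nat a d)"
  by (rule eq_matI)
    (auto simp: cons_block_def mat_diag_def four_block_mat_def Let_def split: nat.splits)

lemma cons_block_one: "cons_block m 1 (1\<^sub>m m) = 1\<^sub>m (Suc m)"
  by (rule eq_matI) (auto simp: cons_block_def mat_diag_def four_block_mat_def Let_def)

lemma cons_block_eq_oneD:
  assumes "B \<in> carrier_mat m m" "cons_block m a B = 1\<^sub>m (Suc m)"
  shows "B = 1\<^sub>m m"
proof (rule eq_matI)
  fix i j assume "i < dim_row (1\<^sub>m m :: complex mat)" "j < dim_col (1\<^sub>m m :: complex mat)"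
  then have ij: "i < m" "j < m" by auto
  have "B $$ (i, j) = cons_block m a B $$ (Suc i, Suc j)"
    using ij assms(1) by (simp add: cons_block_def mat_diag_def four_block_mat_def Let_def)
  then show "B $$ (i, j) = (1\<^sub>m m :: complex mat) $$ (i, j)" using ij assms(2) by simp
qed (use assms in auto)

text \<open>One direction passes unitarity on to the block left by deflation; the other lifts a
  matrix diagonalizing that block to the full size.\<close>

lemma cons_block_unitary_iff:
  assumes B: "B \<in> carrier_mat m m"
  shows "cons_block m a B \<in> carrier (unitary_group (Suc m))
    \<longleftrightarrow> cnj a * a = 1 \<and> B \<in> carrier (unitary_group m)"
proof -
  have eq: "mat_adjoint (cons_block m a B) * cons_block m a B
      = cons_block m (cnj a * a) (mat_adjoint B * B)"
    using B by (simp add: cons_block_adjoint cons_block_mult)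
  show ?thesis
  proof
    assume "cons_block m a B \<in> carrier (unitary_group (Suc m))"
    then have one: "cons_block m (cnj a * a) (mat_adjoint B * B) = 1\<^sub>m (Suc m)"
      using unitary_groupD(2) eq by metis
    have BB: "mat_adjoint B * B \<in> carrier_mat m m" using B by auto
    have "cnj a * a = cons_block m (cnj a * a) (mat_adjoint B * B) $$ (0, 0)"
      using BB by (simp add: cons_block_def mat_diag_def four_block_mat_def Let_def)
    also have "\<dots> = 1" unfolding one by simp
    finally show "cnj a * a = 1 \<and> B \<in> carrier (unitary_group m)"
      using cons_block_eq_oneD[OF BB one] B by (auto intro: unitary_groupI)
  next
    assume "cnj a * a = 1 \<and> B \<in> carrier (unitary_group m)"
    then show "cons_block m a B \<in> carrier (unitary_group (Suc m))"
      using B eq unitary_groupD(2)[of B m]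
      by (intro unitary_groupI) (auto simp: cons_block_carrier cons_block_one)
  qed
qed

text \<open>\<open>W\<close> gets a multiple of an eigenvector for \<open>e\<close> as its first
  column. Conjugation then clears the first column below \<open>e\<close>, and unitarity clears the
  first row.\<close>

lemma unitary_deflation:
  assumes A: "A \<in> carrier (unitary_group (Suc m))" and e: "eigenvalue A e"
  obtains W B where "W \<in> carrier (unitary_group (Suc m))" "B \<in> carrier (unitary_group m)"
    "mat_adjoint W * A * W = cons_block m e B"
proof -
  let ?n = "Suc m"
  note a = unitary_groupD[OF A]
  obtain x where x: "x \<in> carrier_vec ?n" "x \<noteq> 0\<^sub>v ?n" "A *\<^sub>v x = e \<cdot>\<^sub>v x"
    using e a(1) unfolding eigenvalue_def eigenvector_def by auto
  define r where "r = sqrt (\<Sum>i<?n. (cmod (x $ i))\<^sup>2)"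
  have "\<exists>i<?n. x $ i \<noteq> 0"
    using x(1,2) by (metis carrier_vecD eq_vecI index_zero_vec(1) index_zero_vec(2))
  then obtain i where i: "i < ?n" "x $ i \<noteq> 0" by blast
  have "0 < (\<Sum>i<?n. (cmod (x $ i))\<^sup>2)"
    using i by (intro sum_pos2[of _ i]) auto
  then have r: "r > 0" "r\<^sup>2 = (\<Sum>i<?n. (cmod (x $ i))\<^sup>2)" unfolding r_def by auto
  have "(x $ i / of_real r) * cnj (x $ i / of_real r) = of_real ((cmod (x $ i))\<^sup>2) / of_real (r\<^sup>2)"
    for i unfolding complex_norm_square by (simp add: power2_eq_square)
  then have "(\<Sum>i<?n. (x $ i / of_real r) * cnj (x $ i / of_real r)) = of_real (r\<^sup>2) / of_real (r\<^sup>2)"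
    unfolding r(2) of_real_sum sum_divide_distrib by simp
  also have "\<dots> = 1" using r(1) by simp
  finally obtain W k where W: "W \<in> carrier (unitary_group ?n)" "k \<noteq> 0"
    "\<And>i. i < ?n \<Longrightarrow> W $$ (i, 0) = k * (x $ i / of_real r)"
    using unitary_first_column[of ?n "\<lambda>i. x $ i / of_real r"] by blast
  note w = unitary_groupD[OF W(1)]
  define A' where "A' = mat_adjoint W * A * W"
  have A': "A' \<in> carrier (unitary_group ?n)"
    unfolding A'_def using A W by (intro mult_in_unitary_group adjoint_in_unitary_group)
  note a' = unitary_groupD[OF A']
  have AW: "(A * W) $$ (i, 0) = e * W $$ (i, 0)" if "i < ?n" for i
  proof -
    have "(A * W) $$ (i, 0) = (\<Sum>j<?n. A $$ (i, j) * W $$ (j, 0))"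
      using that a(1) w(1) by (auto simp: scalar_prod_def atLeast0LessThan intro!: sum.cong)
    also have "\<dots> = (\<Sum>j<?n. k / of_real r * (A $$ (i, j) * x $ j))"
      by (intro sum.cong) (auto simp: W(3))
    also have "\<dots> = k / of_real r * (\<Sum>j<?n. A $$ (i, j) * x $ j)"
      by (rule sum_distrib_left[symmetric])
    also have "(\<Sum>j<?n. A $$ (i, j) * x $ j) = (A *\<^sub>v x) $ i"
      using that a(1) x(1) by (auto simp: scalar_prod_def atLeast0LessThan intro!: sum.cong)
    also have "\<dots> = e * x $ i" using x that by simp
    finally show ?thesis using that by (simp add: W(3))
  qed
  have col0: "A' $$ (i, 0) = (if i = 0 then e else 0)" if "i < ?n" for i
  proof -
    have "A' = mat_adjoint W * (A * W)"
      unfolding A'_def using a(1) w(1) by (intro assoc_mult_mat[of _ ?n ?n _ ?n _ ?n]) auto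
    then have "A' $$ (i, 0) = (\<Sum>l<?n. cnj (W $$ (l, i)) * (A * W) $$ (l, 0))"
      using that a(1) w(1) by (auto simp: scalar_prod_def atLeast0LessThan intro!: sum.cong)
    also have "\<dots> = (\<Sum>l<?n. e * (cnj (W $$ (l, i)) * W $$ (l, 0)))"
      by (intro sum.cong) (auto simp: AW)
    also have "\<dots> = e * (\<Sum>l<?n. cnj (W $$ (l, i)) * W $$ (l, 0))"
      by (rule sum_distrib_left[symmetric])
    also have "(\<Sum>l<?n. cnj (W $$ (l, i)) * W $$ (l, 0)) = (mat_adjoint W * W) $$ (i, 0)"
      using that w(1) by (auto simp: scalar_prod_def atLeast0LessThan intro!: sum.cong)
    finally show ?thesis using that w(2) by simp
  qed
  have e1: "e \<noteq> 0" using norm_eigenvalue_unitary[OF A e] by auto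
  \<comment> \<open>Column 0 of \<open>A'\<close> has the single nonzero entry \<open>e\<close>, so
    its orthogonality to column \<open>j\<close> reads
    \<open>cnj e * A' $$ (0, j) = 0\<close>.\<close>
  have row0: "A' $$ (0, j) = 0" if "0 < j" "j < ?n" for j
  proof -
    have "(\<Sum>l<?n. cnj (A' $$ (l, 0)) * A' $$ (l, j)) = (mat_adjoint A' * A') $$ (0, j)"
      using that a'(1) by (auto simp: scalar_prod_def atLeast0LessThan intro!: sum.cong)
    also have "\<dots> = 0" using that a'(2) by simp
    also have "(\<Sum>l<?n. cnj (A' $$ (l, 0)) * A' $$ (l, j))
        = (\<Sum>l<?n. if l = 0 then cnj e * A' $$ (0, j) else 0)"
      by (intro sum.cong) (auto simp: col0)
    also have "\<dots> = cnj e * A' $$ (0, j)" by (subst sum.delta) auto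
    finally show ?thesis using e1 by simp
  qed
  define B where "B = mat m m (\<lambda>(i, j). A' $$ (Suc i, Suc j))"
  have B: "B \<in> carrier_mat m m" by (simp add: B_def)
  have block: "A' = cons_block m e B"
    by (rule eq_matI) (use a'(1) col0 row0 in
      \<open>auto simp: cons_block_def mat_diag_def four_block_mat_def Let_def B_def\<close>)
  show thesis
  proof
    show "W \<in> carrier (unitary_group ?n)" by fact
    show "B \<in> carrier (unitary_group m)"
      using A' cons_block_unitary_iff[OF B] unfolding block by blast
    show "mat_adjoint W * A * W = cons_block m e B" using block A'_def by simp
  qed
qed

lemma char_poly_unitary_conj:
  assumes V: "V \<in> carrier (unitary_group n)" and B: "B \<in> carrier_mat n n"
  shows "char_poly (V * B * mat_adjoint V) = char_poly B"
proof (rule char_poly_similar, rule similar_matI)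
  note v = unitary_groupD[OF V]
  show "{V * B * mat_adjoint V, B, V, mat_adjoint V} \<subseteq> carrier_mat n n" using v B by auto
qed (use unitary_groupD[OF V] in auto)

lemma char_poly_cons_block:
  assumes B: "B \<in> carrier_mat m m"
  shows "char_poly (cons_block m e B) = [:- e, 1:] * char_poly B"
proof -
  have "char_poly (mat_diag 1 (\<lambda>_. e)) = [:- e, 1:]"
    by (subst char_poly_upper_triangular[of _ 1]) (auto simp: mat_diag_def diag_mat_def)
  then show ?thesis unfolding cons_block_def
    by (subst char_poly_four_block_zeros_col[of _ _ m]) (use B in auto)
qed

lemma unitary_mult_cancel:
  assumes V: "V \<in> carrier (unitary_group n)" and B: "B \<in> carrier_mat n n"
  shows "V * (mat_adjoint V * B) = B" "mat_adjoint V * (V * B) = B"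
    "B * V * mat_adjoint V = B" "B * mat_adjoint V * V = B"
proof -
  note v = unitary_groupD[OF V] and v' = mat_adjoint_carrier[OF unitary_groupD(1)[OF V]]
  show "V * (mat_adjoint V * B) = B"
    using assoc_mult_mat[OF v(1) v' B] v(3) B by simp
  show "mat_adjoint V * (V * B) = B"
    using assoc_mult_mat[OF v' v(1) B] v(2) B by simp
  show "B * V * mat_adjoint V = B"
    using assoc_mult_mat[OF B v(1) v'] v(3) B by simp
  show "B * mat_adjoint V * V = B"
    using assoc_mult_mat[OF B v' v(1)] v(2) B by simp
qed

lemma mult_conj_assoc:
  assumes "W \<in> carrier_mat n n" "V \<in> carrier_mat n n" "D \<in> carrier_mat n n"
    "V' \<in> carrier_mat n n" "W' \<in> carrier_mat n n"
  shows "W * (V * D * V') * W' = (W * V) * D * (V' * W')"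
  using assms by (simp add: assoc_mult_mat[of _ n n _ n _ n])

text \<open>The induction peels off the roots in the order of the list, so the diagonal carries the
  eigenvalues in any prescribed order. Later this permits sorting them by absolute angle.\<close>

lemma unitary_diagonalization:
  assumes "A \<in> carrier (unitary_group n)" "char_poly A = (\<Prod>e\<leftarrow>es. [:- e, 1:])"
  obtains V where "V \<in> carrier (unitary_group n)"
    "A = V * mat_diag n (\<lambda>i. es ! i) * mat_adjoint V"
proof -
  have "\<exists>V \<in> carrier (unitary_group n). A = V * mat_diag n (\<lambda>i. es ! i) * mat_adjoint V"
    using assms
  proof (induction es arbitrary: A n)
    case Nil
    then have "n = 0" using degree_monic_char_poly[OF unitary_groupD(1)[OF Nil(1)]] by auto
    then show ?case using Nil(1) unitary_groupD(1)[OF Nil(1)]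
      by (intro bexI[of _ A]) (auto intro!: eq_matI)
  next
    case (Cons e es)
    note a = unitary_groupD[OF Cons.prems(1)]
    have "n \<noteq> 0"
    proof
      assume "n = 0"
      then have "degree (char_poly A) = 0" using degree_monic_char_poly[OF a(1)] by simp
      moreover have "(\<Prod>e\<leftarrow>es. [:- e, 1:]) \<noteq> 0" by (auto simp: prod_list_zero_iff)
      then have "degree (\<Prod>e\<leftarrow>e # es. [:- e, 1:]) \<noteq> 0"
        by (simp add: degree_mult_eq del: mult_pCons_left)
      ultimately show False using Cons.prems(2) by simp
    qed
    then obtain m where n: "n = Suc m" by (cases n) auto
    have ev: "eigenvalue A e"
      unfolding eigenvalue_root_char_poly[OF a(1)] Cons.prems(2) by simp
    obtain W B where W: "W \<in> carrier (unitary_group n)" and B: "B \<in> carrier (unitary_group m)"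
      and WAW: "mat_adjoint W * A * W = cons_block m e B"
      using unitary_deflation[of A m e] Cons.prems(1) ev unfolding n by blast
    note w = unitary_groupD[OF W] and w' = mat_adjoint_carrier[OF unitary_groupD(1)[OF W]]
    note b = unitary_groupD[OF B]
    have C: "cons_block m e B \<in> carrier_mat n n" using b(1) n cons_block_carrier by auto
    have A_eq: "A = W * cons_block m e B * mat_adjoint W"
    proof -
      have "W * (mat_adjoint W * A * W) = A * W"
        using unitary_mult_cancel(1)[OF W, of "A * W"] a(1) w w'
        by (simp add: assoc_mult_mat[of _ n n _ n _ n])
      then show ?thesis using unitary_mult_cancel(3)[OF W a(1)] unfolding WAW by simp
    qed
    \<comment> \<open>Cancelling the linear factor leaves the remaining list as the roots of
      \<open>B\<close>, as the induction hypothesis requires.\<close>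
    have "[:- e, 1:] * char_poly B = [:- e, 1:] * (\<Prod>e\<leftarrow>es. [:- e, 1:])"
      using Cons.prems(2) char_poly_unitary_conj[OF W C] char_poly_cons_block[OF b(1)]
      unfolding A_eq[symmetric] by simp
    then have "char_poly B = (\<Prod>e\<leftarrow>es. [:- e, 1:])"
      by (metis mult_left_cancel pCons_eq_0_iff one_neq_zero)
    from Cons.IH[OF B this] obtain V where V: "V \<in> carrier (unitary_group m)"
      and B_eq: "B = V * mat_diag m (\<lambda>i. es ! i) * mat_adjoint V" by blast
    note v = unitary_groupD[OF V] and v' = mat_adjoint_carrier[OF unitary_groupD(1)[OF V]]
    let ?V = "cons_block m 1 V"
    have V1: "?V \<in> carrier (unitary_group n)" using V cons_block_unitary_iff[OF v(1)] n by simp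
    note v1 = unitary_groupD[OF V1] and v1' = mat_adjoint_carrier[OF unitary_groupD(1)[OF V1]]
    let ?D = "mat_diag n (\<lambda>i. (e # es) ! i)"
    have D: "cons_block m e (mat_diag m (\<lambda>i. es ! i)) = ?D"
      unfolding cons_block_mat_diag n by (intro arg_cong[of _ _ "mat_diag _"]) (auto split: nat.splits)
    have "cons_block m e B = ?V * ?D * mat_adjoint ?V"
      unfolding D[symmetric] cons_block_adjoint[OF v(1)]
      using v(1) v' by (simp add: cons_block_mult B_eq)
    then have "A = W * (?V * ?D * mat_adjoint ?V) * mat_adjoint W" using A_eq by simp
    also have "\<dots> = (W * ?V) * ?D * mat_adjoint (W * ?V)"
      using w(1) w' v1(1) v1'
      by (simp add: mat_adjoint_mult[OF w(1) v1(1)] mult_conj_assoc[of W n ?V ?D])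
    finally show ?case using mult_in_unitary_group[OF W V1] by blast
  qed
  then show thesis using that by blast
qed

lemma char_poly_diagonalized:
  assumes "V \<in> carrier (unitary_group n)"
  shows "char_poly (V * mat_diag n d * mat_adjoint V) = (\<Prod>i\<leftarrow>[0..<n]. [:- d i, 1:])"
proof -
  have "diag_mat (mat_diag n d) = map d [0..<n]"
    by (auto simp: diag_mat_def mat_diag_def)
  moreover have "upper_triangular (mat_diag n d)" by (auto simp: mat_diag_def)
  ultimately show ?thesis
    using char_poly_unitary_conj[OF assms, of "mat_diag n d"]
      char_poly_upper_triangular[of "mat_diag n d" n] by (simp add: comp_def)
qed

text \<open>The angles are arbitrary reals, not principal arguments, so they can be scaled, negated
  and added while the eigenbasis \<open>V\<close> stays fixed.\<close>

definition angle_decomp :: "nat \<Rightarrow> complex mat \<Rightarrow> complex mat \<Rightarrow> (nat \<Rightarrow> real) \<Rightarrow> bool" where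
  "angle_decomp n A V a \<longleftrightarrow> V \<in> carrier (unitary_group n)
    \<and> A = V * mat_diag n (\<lambda>i. cis (a i)) * mat_adjoint V"

text \<open>The order is by absolute value, as majorization demands, and the interval is closed at
  both ends, unlike for \<open>eigenangles\<close>.\<close>

definition sorted_angles :: "nat \<Rightarrow> (nat \<Rightarrow> real) \<Rightarrow> bool" where
  "sorted_angles n a \<longleftrightarrow> (\<forall>i<n. \<bar>a i\<bar> \<le> pi) \<and> (\<forall>j<n. \<forall>i\<le>j. \<bar>a j\<bar> \<le> \<bar>a i\<bar>)"

lemma mat_diag_cis_unitary: "mat_diag n (\<lambda>i. cis (a i)) \<in> carrier (unitary_group n)"
  by (rule unitary_groupI) (auto simp: mat_adjoint_mat_diag cis_cnj cis_mult)

lemma angle_decomp_unitary: "angle_decomp n A V a \<Longrightarrow> A \<in> carrier (unitary_group n)"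
  unfolding angle_decomp_def
  by (auto intro!: mult_in_unitary_group adjoint_in_unitary_group mat_diag_cis_unitary)

lemma sorted_angle_decomp_exists:
  assumes A: "A \<in> carrier (unitary_group n)"
  obtains V a where "angle_decomp n A V a" "sorted_angles n a"
proof -
  \<comment> \<open>\<open>eigenangles\<close> is sorted by signed value; here the same angles are
    rearranged by decreasing absolute value.\<close>
  define ts where "ts = rev (sort_key abs (eigenangles A))"
  have len: "length ts = n" using length_eigenangles[OF A] by (simp add: ts_def)
  have E: "char_poly A = (\<Prod>a\<leftarrow>eigenangles A. [:- cis a, 1:])" "set (eigenangles A) \<subseteq> {-pi<..pi}"
    using eigenangles_eq_iff[OF A] by blast+
  have "mset (map (\<lambda>a. [:- cis a, 1:]) ts) = mset (map (\<lambda>a. [:- cis a, 1:]) (eigenangles A))"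
    by (simp add: ts_def)
  then have "char_poly A = (\<Prod>e\<leftarrow>map cis ts. [:- e, 1:])"
    unfolding E(1) by (simp add: comp_def prod_mset_prod_list[symmetric] del: mset_map)
  with A obtain V where V: "V \<in> carrier (unitary_group n)"
    "A = V * mat_diag n (\<lambda>i. map cis ts ! i) * mat_adjoint V"
    by (rule unitary_diagonalization)
  have "mat_diag n (\<lambda>i. map cis ts ! i) = mat_diag n (\<lambda>i. cis (ts ! i))"
    by (rule eq_matI) (auto simp: mat_diag_def len)
  note V(2)[unfolded this]
  moreover have "\<bar>ts ! i\<bar> \<le> pi" if "i < n" for i
  proof -
    have "ts ! i \<in> set (eigenangles A)" using nth_mem[of i ts] that len by (simp add: ts_def)
    then show ?thesis using E(2) by (auto simp: abs_le_iff)
  qed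
  moreover have "\<bar>ts ! j\<bar> \<le> \<bar>ts ! i\<bar>" if "i \<le> j" "j < n" for i j
  proof -
    have "sorted_wrt (\<ge>) (map abs ts)"
      by (simp add: ts_def rev_map[symmetric] sorted_wrt_rev)
    then show ?thesis using that len
      by (cases "i = j") (auto simp: sorted_wrt_iff_nth_less)
  qed
  ultimately show thesis using that[of V "\<lambda>i. ts ! i"] V(1)
    by (simp add: angle_decomp_def sorted_angles_def)
qed

section \<open>Eigenangles of products\<close>

text \<open>The quadratic form of a normal matrix at column \<open>j\<close> of \<open>W\<close>,
  expanded in the eigenbasis \<open>V\<close>. The squared moduli are the spectral measure at that
  column.\<close>

lemma diagonal_of_conj:
  assumes V: "V \<in> carrier (unitary_group n)" and W: "W \<in> carrier (unitary_group n)" and j: "j < n"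
  shows "(mat_adjoint W * (V * mat_diag n d * mat_adjoint V) * W) $$ (j, j)
    = (\<Sum>l<n. of_real ((cmod ((mat_adjoint V * W) $$ (l, j)))\<^sup>2) * d l)"
proof -
  note v = unitary_groupD(1)[OF V] mat_adjoint_carrier[OF unitary_groupD(1)[OF V]]
  note w = unitary_groupD(1)[OF W] mat_adjoint_carrier[OF unitary_groupD(1)[OF W]]
  define X where "X = mat_adjoint V * W"
  have X: "X \<in> carrier_mat n n" unfolding X_def by (rule mult_carrier_mat[OF v(2) w(1)])
  have "mat_adjoint W * (V * mat_diag n d * mat_adjoint V) * W = mat_adjoint X * mat_diag n d * X"
    using v w by (simp add: X_def mult_conj_assoc[of _ n] mat_adjoint_mult[OF v(2) w(1)])
  also have "\<dots> = mat_adjoint X * (mat_diag n d * X)"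
    using X by (intro assoc_mult_mat[of _ n n _ n _ n]) auto
  also have "\<dots> $$ (j, j) = (\<Sum>l<n. cnj (X $$ (l, j)) * (d l * X $$ (l, j)))"
    using X j by (auto simp: mat_diag_mult_left[OF X] scalar_prod_def atLeast0LessThan intro!: sum.cong)
  also have "\<dots> = (\<Sum>l<n. of_real ((cmod (X $$ (l, j)))\<^sup>2) * d l)"
    unfolding complex_norm_square by (intro sum.cong) auto
  finally show ?thesis by (simp only: X_def)
qed

lemma unitary_column_norm:
  assumes X: "X \<in> carrier (unitary_group n)" and j: "j < n"
  shows "(\<Sum>l<n. (cmod (X $$ (l, j)))\<^sup>2) = 1"
proof -
  note x = unitary_groupD[OF X]
  have "of_real (\<Sum>l<n. (cmod (X $$ (l, j)))\<^sup>2) = (\<Sum>l<n. cnj (X $$ (l, j)) * X $$ (l, j))"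
    unfolding of_real_sum complex_norm_square by (intro sum.cong) auto
  also have "\<dots> = (mat_adjoint X * X) $$ (j, j)"
    using x(1) j by (auto simp: scalar_prod_def atLeast0LessThan intro!: sum.cong)
  also have "\<dots> = of_real 1" using x(2) j by simp
  finally show ?thesis unfolding of_real_eq_iff .
qed

lemma unitary_row_norm:
  assumes X: "X \<in> carrier (unitary_group n)" and l: "l < n"
  shows "(\<Sum>j<n. (cmod (X $$ (l, j)))\<^sup>2) = 1"
proof -
  have "(\<Sum>j<n. (cmod (X $$ (l, j)))\<^sup>2) = (\<Sum>j<n. (cmod (mat_adjoint X $$ (j, l)))\<^sup>2)"
    using unitary_groupD(1)[OF X] l by (intro sum.cong) auto
  then show ?thesis using unitary_column_norm[OF adjoint_in_unitary_group[OF X] l] by simp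
qed

lemma angle_decomp_adjoint:
  assumes "angle_decomp n A V a"
  shows "angle_decomp n (mat_adjoint A) V (\<lambda>i. - a i)"
proof -
  have V: "V \<in> carrier (unitary_group n)" and A: "A = V * mat_diag n (\<lambda>i. cis (a i)) * mat_adjoint V"
    using assms by (auto simp: angle_decomp_def)
  note v = unitary_groupD(1)[OF V] mat_adjoint_carrier[OF unitary_groupD(1)[OF V]]
  let ?D = "mat_diag n (\<lambda>i. cis (a i))"
  have D: "?D \<in> carrier_mat n n" "mat_adjoint ?D \<in> carrier_mat n n" by auto
  have "mat_adjoint A = V * (mat_adjoint ?D * mat_adjoint V)"
    unfolding A using v D
    by (subst mat_adjoint_mult[of _ n n _ n]) (auto simp: mat_adjoint_mult[OF v(1) D(1)])
  also have "\<dots> = V * mat_adjoint ?D * mat_adjoint V"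
    using v D by (simp add: assoc_mult_mat[of _ n n _ n _ n])
  finally show ?thesis using V by (simp add: angle_decomp_def mat_adjoint_mat_diag cis_cnj)
qed

lemma angle_decomp_mult:
  assumes "angle_decomp n A V a" "angle_decomp n B V b"
  shows "angle_decomp n (A * B) V (\<lambda>i. a i + b i)"
proof -
  have V: "V \<in> carrier (unitary_group n)" and A: "A = V * mat_diag n (\<lambda>i. cis (a i)) * mat_adjoint V"
    and B: "B = V * mat_diag n (\<lambda>i. cis (b i)) * mat_adjoint V"
    using assms by (auto simp: angle_decomp_def)
  note v = unitary_groupD(1)[OF V] mat_adjoint_carrier[OF unitary_groupD(1)[OF V]]
  let ?D = "mat_diag n (\<lambda>i. cis (a i))" and ?E = "mat_diag n (\<lambda>i. cis (b i))"
  have D: "?D \<in> carrier_mat n n" "?E \<in> carrier_mat n n" by auto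
  have B': "B = V * (?E * mat_adjoint V)"
    unfolding B using v D by (intro assoc_mult_mat[of _ n n _ n _ n])
  have EV: "?E * mat_adjoint V \<in> carrier_mat n n" by (rule mult_carrier_mat[OF D(2) v(2)])
  have VD: "V * ?D \<in> carrier_mat n n" by (rule mult_carrier_mat[OF v(1) D(1)])
  have "A * B = V * ?D * (mat_adjoint V * (V * (?E * mat_adjoint V)))"
    unfolding A B' using assoc_mult_mat[OF VD v(2), of "V * (?E * mat_adjoint V)" n] v(1) EV by simp
  also have "\<dots> = V * ?D * (?E * mat_adjoint V)"
    using unitary_mult_cancel(2)[OF V EV] by simp
  also have "\<dots> = V * ?D * ?E * mat_adjoint V"
    using assoc_mult_mat[OF VD D(2) v(2)] by simp
  also have "V * ?D * ?E = V * (?D * ?E)" by (rule assoc_mult_mat[OF v(1) D])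
  finally show ?thesis using V by (simp add: angle_decomp_def cis_mult)
qed

lemma angle_decomp_zero:
  assumes "angle_decomp n A V (\<lambda>_. 0)" shows "A = 1\<^sub>m n"
proof -
  have "V \<in> carrier (unitary_group n)" "A = V * mat_diag n (\<lambda>_. 1) * mat_adjoint V"
    using assms by (auto simp: angle_decomp_def)
  then show ?thesis using unitary_groupD[of V n] by simp
qed

text \<open>Write \<open>U\<close> as \<open>(U * E) * mat_adjoint E\<close>. Column
  \<open>j\<close> of \<open>W\<close> is an eigenvector of \<open>U * E\<close>, so the quadratic
  form of \<open>U\<close> there is \<open>cis (c j)\<close> times that of
  \<open>mat_adjoint E\<close>.\<close>

lemma angle_decomp_spectral_measures:
  assumes U: "angle_decomp n U V a" and E: "angle_decomp n E Z b"
    and UE: "angle_decomp n (U * E) W c" and j: "j < n"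
  shows "(\<Sum>l<n. of_real ((cmod ((mat_adjoint V * W) $$ (l, j)))\<^sup>2) * cis (a l))
    = cis (c j) * (\<Sum>l<n. of_real ((cmod ((mat_adjoint Z * W) $$ (l, j)))\<^sup>2) * cis (- b l))"
proof -
  have V: "V \<in> carrier (unitary_group n)" "U = V * mat_diag n (\<lambda>i. cis (a i)) * mat_adjoint V"
    using U by (auto simp: angle_decomp_def)
  have W: "W \<in> carrier (unitary_group n)" "U * E = W * mat_diag n (\<lambda>i. cis (c i)) * mat_adjoint W"
    using UE by (auto simp: angle_decomp_def)
  have Z: "Z \<in> carrier (unitary_group n)"
    "mat_adjoint E = Z * mat_diag n (\<lambda>i. cis (- b i)) * mat_adjoint Z"
    using angle_decomp_adjoint[OF E] by (auto simp: angle_decomp_def)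
  note e = unitary_groupD[OF angle_decomp_unitary[OF E]]
  note e' = mat_adjoint_carrier[OF e(1)]
  note u = unitary_groupD[OF angle_decomp_unitary[OF U]]
  note w = unitary_groupD[OF W(1)] and w' = mat_adjoint_carrier[OF unitary_groupD(1)[OF W(1)]]
  let ?D = "mat_diag n (\<lambda>i. cis (c i))"
  have D: "?D \<in> carrier_mat n n" by simp
  have wew: "mat_adjoint W * mat_adjoint E * W \<in> carrier_mat n n" using w w' e' by auto
  have "U = U * E * mat_adjoint E"
    using unitary_mult_cancel(3)[OF angle_decomp_unitary[OF E] u(1)] by simp
  then have "mat_adjoint W * U * W = mat_adjoint W * (W * ?D * mat_adjoint W * mat_adjoint E) * W"
    unfolding W(2) by simp
  also have "\<dots> = (mat_adjoint W * W) * (?D * (mat_adjoint W * mat_adjoint E * W))"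
    using w(1) w' e' D wew by (simp add: assoc_mult_mat[of _ n n _ n _ n] mult_carrier_mat[of _ n n _ n])
  also have "\<dots> = ?D * (mat_adjoint W * mat_adjoint E * W)"
    unfolding w(2) by (rule left_mult_one_mat[OF mult_carrier_mat[OF D wew]])
  finally have "(mat_adjoint W * U * W) $$ (j, j)
      = cis (c j) * (mat_adjoint W * mat_adjoint E * W) $$ (j, j)"
    using j by (simp add: mat_diag_mult_left[OF wew])
  then show ?thesis
    using diagonal_of_conj[OF V(1) W(1) j, of "\<lambda>i. cis (a i)", folded V(2)]
      diagonal_of_conj[OF Z(1) W(1) j, of "\<lambda>i. cis (- b i)", folded Z(2)] by simp
qed

text \<open>The squared moduli of a unitary matrix are doubly stochastic: over \<open>k\<close>
  columns each row collects weight at most 1, and the total is \<open>k\<close>.\<close>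

lemma partial_sum_of_averages_le:
  assumes X: "X \<in> carrier (unitary_group n)" and k: "k \<le> n"
    and u: "\<And>i j. i \<le> j \<Longrightarrow> j < n \<Longrightarrow> u j \<le> u i"
  shows "(\<Sum>j<k. \<Sum>l<n. (cmod (X $$ (l, j)))\<^sup>2 * u l) \<le> (\<Sum>l<k. u l)"
proof -
  have "(\<Sum>j<k. \<Sum>l<n. (cmod (X $$ (l, j)))\<^sup>2 * u l)
      = (\<Sum>l<n. (\<Sum>j<k. (cmod (X $$ (l, j)))\<^sup>2) * u l)"
    by (subst sum.swap) (simp add: sum_distrib_right)
  also have "\<dots> \<le> (\<Sum>l<k. u l)"
  proof (rule weighted_sum_le_partial_sum[OF _ _ _ u k])
    show "(\<Sum>j<k. (cmod (X $$ (l, j)))\<^sup>2) \<le> 1" if "l < n" for l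
      unfolding unitary_row_norm[OF X that, symmetric] using k by (intro sum_mono2) auto
    have "(\<Sum>l<n. \<Sum>j<k. (cmod (X $$ (l, j)))\<^sup>2) = (\<Sum>j<k. \<Sum>l<n. (cmod (X $$ (l, j)))\<^sup>2)"
      by (rule sum.swap)
    also have "\<dots> = (\<Sum>j<k. 1)"
      using k by (intro sum.cong refl unitary_column_norm[OF X]) auto
    finally show "(\<Sum>l<n. \<Sum>j<k. (cmod (X $$ (l, j)))\<^sup>2) = real k" by simp
  qed (auto intro: sum_nonneg)
  finally show ?thesis .
qed

text \<open>The function \<open>arccos (\<rho> * cos t)\<close> is even and increases with
  \<open>\<bar>t\<bar>\<close> up to \<open>pi\<close>, so sorting by absolute value sorts its
  values too.\<close>

lemma arccos_scaled_antimono: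
  assumes \<rho>: "0 < \<rho>" "\<rho> < 1" and a: "sorted_angles n a" and ij: "i \<le> j" "j < n"
  shows "arccos (\<rho> * cos (a j)) \<le> arccos (\<rho> * cos (a i))"
proof (rule arccos_le_arccos)
  have "\<bar>a j\<bar> \<le> \<bar>a i\<bar>" "\<bar>a i\<bar> \<le> pi" using a ij by (auto simp: sorted_angles_def)
  then have "cos \<bar>a i\<bar> \<le> cos \<bar>a j\<bar>" by (intro cos_monotone_0_pi_le) auto
  then show "\<rho> * cos (a i) \<le> \<rho> * cos (a j)" using \<rho> by simp
  have "\<bar>\<rho> * cos x\<bar> \<le> 1" for x
    using \<rho> by (simp add: abs_mult mult_le_one)
  then show "-1 \<le> \<rho> * cos (a i)" "\<rho> * cos (a j) \<le> 1" by (auto simp: abs_le_iff minus_le_iff)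
qed

text \<open>\<open>K\<close> depends on \<open>\<rho>\<close> alone, so one constant serves all
  steps of the later iteration. The angles \<open>c\<close> may come in any order.\<close>

lemma small_rotation_step:
  assumes \<rho>: "0 < \<rho>" "\<rho> < 1"
  obtains K where "0 \<le> K" "\<And>n U E V Z W a b c k h.
      angle_decomp n U V a \<Longrightarrow> sorted_angles n a \<Longrightarrow>
      angle_decomp n E Z (\<lambda>i. h * b i) \<Longrightarrow> sorted_angles n b \<Longrightarrow> 0 \<le> h \<Longrightarrow>
      angle_decomp n (U * E) W c \<Longrightarrow> k \<le> n \<Longrightarrow>
      (\<Sum>j<k. arccos (\<rho> * cos (c j))) \<le> (\<Sum>l<k. arccos (\<rho> * cos (a l)))
        + h * (\<Sum>l<k. \<bar>b l\<bar>) + real k * K * h\<^sup>2"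
proof -
  obtain C where C: "0 \<le> C"
    "\<And>u v. \<bar>u\<bar> \<le> 1 \<Longrightarrow> \<bar>v\<bar> \<le> 1 \<Longrightarrow>
      arccos (\<rho> * u) - \<rho> / sqrt (1 - (\<rho> * u)\<^sup>2) * (v - u) - C * (v - u)\<^sup>2 \<le> arccos (\<rho> * v)"
    using arccos_scaled_tangent[OF \<rho>] by blast
  define K where "K = (C + 1 / sqrt (1 - \<rho>\<^sup>2)) * pi\<^sup>2"
  show thesis
  proof
    have "\<rho>\<^sup>2 \<le> 1" using \<rho> by (simp add: power_le_one)
    then show "0 \<le> K" using C(1) by (simp add: K_def)
    fix n U E V Z W and a b c :: "nat \<Rightarrow> real" and k and h :: real
    assume U: "angle_decomp n U V a" "sorted_angles n a"
      and E: "angle_decomp n E Z (\<lambda>i. h * b i)" "sorted_angles n b" and h: "0 \<le> h"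
      and UE: "angle_decomp n (U * E) W c" and k: "k \<le> n"
    have VW: "mat_adjoint V * W \<in> carrier (unitary_group n)"
      and ZW: "mat_adjoint Z * W \<in> carrier (unitary_group n)"
      using U E UE by (auto simp: angle_decomp_def intro!: mult_in_unitary_group adjoint_in_unitary_group)
    define p where "p l j = (cmod ((mat_adjoint V * W) $$ (l, j)))\<^sup>2" for l j
    define q where "q l j = (cmod ((mat_adjoint Z * W) $$ (l, j)))\<^sup>2" for l j
    have "(\<Sum>j<k. arccos (\<rho> * cos (c j)))
      \<le> (\<Sum>j<k. (\<Sum>l<n. p l j * arccos (\<rho> * cos (a l))) + h * (\<Sum>l<n. q l j * \<bar>b l\<bar>) + K * h\<^sup>2)"
    proof (rule sum_mono)
      fix j assume "j \<in> {..<k}"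
      then have j: "j < n" using k by simp
      show "arccos (\<rho> * cos (c j)) \<le>
        (\<Sum>l<n. p l j * arccos (\<rho> * cos (a l))) + h * (\<Sum>l<n. q l j * \<bar>b l\<bar>) + K * h\<^sup>2"
        unfolding K_def
      proof (rule arccos_scaled_step[OF \<rho> C])
        show "(\<Sum>l<n. p l j) = 1" "(\<Sum>l<n. q l j) = 1"
          unfolding p_def q_def using unitary_column_norm[OF VW j] unitary_column_norm[OF ZW j]
          by auto
        show "(\<Sum>l<n. of_real (p l j) * cis (a l))
            = cis (c j) * (\<Sum>l<n. of_real (q l j) * cis (- (h * b l)))"
          unfolding p_def q_def by (rule angle_decomp_spectral_measures[OF U(1) E(1) UE j])
      qed (use E(2) h in \<open>auto simp: p_def q_def sorted_angles_def\<close>)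
    qed
    also have "\<dots> = (\<Sum>j<k. \<Sum>l<n. p l j * arccos (\<rho> * cos (a l)))
        + h * (\<Sum>j<k. \<Sum>l<n. q l j * \<bar>b l\<bar>) + real k * K * h\<^sup>2"
      by (simp add: sum.distrib sum_distrib_left)
    also have "\<dots> \<le> (\<Sum>l<k. arccos (\<rho> * cos (a l))) + h * (\<Sum>l<k. \<bar>b l\<bar>) + real k * K * h\<^sup>2"
      unfolding p_def q_def using h E(2)
      by (intro add_mono mult_left_mono partial_sum_of_averages_le[OF VW k]
          partial_sum_of_averages_le[OF ZW k] order_refl arccos_scaled_antimono[OF \<rho> U(2)])
        (auto simp: sorted_angles_def)
    finally show "(\<Sum>j<k. arccos (\<rho> * cos (c j))) \<le> (\<Sum>l<k. arccos (\<rho> * cos (a l)))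
        + h * (\<Sum>l<k. \<bar>b l\<bar>) + real k * K * h\<^sup>2" .
  qed
qed

text \<open>\<open>B\<close> is split into \<open>m\<close> equal rotations with its own eigenbasis.
  Each has \<open>h = 1 / m\<close> and an error proportional to \<open>h^2\<close>, so the total
  error is of order \<open>1 / m\<close>.\<close>

lemma arccos_scaled_sum_mult_le:
  assumes \<rho>: "0 < \<rho>" "\<rho> < 1"
    and A: "angle_decomp n A V a" "sorted_angles n a"
    and B: "angle_decomp n B Z b" "sorted_angles n b"
    and AB: "angle_decomp n (A * B) W c" and k: "k \<le> n"
  shows "(\<Sum>j<k. arccos (\<rho> * cos (c j))) \<le> (\<Sum>l<k. arccos (\<rho> * cos (a l))) + (\<Sum>l<k. \<bar>b l\<bar>)"
proof -
  obtain K where K: "0 \<le> K" and step: "\<And>U E V Z W a b c h.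
      angle_decomp n U V a \<Longrightarrow> sorted_angles n a \<Longrightarrow>
      angle_decomp n E Z (\<lambda>i. h * b i) \<Longrightarrow> sorted_angles n b \<Longrightarrow> 0 \<le> h \<Longrightarrow>
      angle_decomp n (U * E) W c \<Longrightarrow>
      (\<Sum>j<k. arccos (\<rho> * cos (c j))) \<le> (\<Sum>l<k. arccos (\<rho> * cos (a l)))
        + h * (\<Sum>l<k. \<bar>b l\<bar>) + real k * K * h\<^sup>2"
    using small_rotation_step[OF \<rho>] k by metis
  let ?S = "\<lambda>c. \<Sum>j<k. arccos (\<rho> * cos (c j))"
  let ?T = "\<Sum>l<k. \<bar>b l\<bar>"
  have Z: "Z \<in> carrier (unitary_group n)" using B(1) by (simp add: angle_decomp_def)
  \<comment> \<open>The one-parameter group through \<open>B\<close>, with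
    \<open>E 1 = B\<close>.\<close>
  define E where "E t = Z * mat_diag n (\<lambda>i. cis (t * b i)) * mat_adjoint Z" for t
  have E: "angle_decomp n (E t) Z (\<lambda>i. t * b i)" for t
    using Z by (simp add: angle_decomp_def E_def)
  have E_add: "E (s + t) = E s * E t" for s t
    using angle_decomp_mult[OF E E, of s t] by (simp add: angle_decomp_def E_def distrib_right)
  have E1: "E 1 = B" using B(1) by (simp add: angle_decomp_def E_def)
  have unitary: "A \<in> carrier (unitary_group n)" "E t \<in> carrier (unitary_group n)" for t
    using angle_decomp_unitary A E by blast+
  have iterate: "?S c \<le> ?S a + real m * (h * ?T + real k * K * h\<^sup>2)"
    if "0 \<le> h" "angle_decomp n (A * E (real m * h)) W c" for h m W c
    using that(2)
  proof (induction m arbitrary: W c)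
    case 0
    \<comment> \<open>A step of size 0 compares the two decompositions of \<open>A\<close>.\<close>
    have "angle_decomp n (E 0) Z (\<lambda>i. 0 * b i)" by (rule E)
    from step[OF A this B(2)] 0 show ?case by simp
  next
    case (Suc m)
    have "A * E (real m * h) \<in> carrier (unitary_group n)"
      using unitary by (intro mult_in_unitary_group)
    \<comment> \<open>The intermediate product is diagonalized afresh, since the next step needs
      sorted angles at its start.\<close>
    then obtain V' a' where V': "angle_decomp n (A * E (real m * h)) V' a'" "sorted_angles n a'"
      by (rule sorted_angle_decomp_exists)
    have "A * E (real (Suc m) * h) = A * E (real m * h) * E h"
      using unitary[THEN unitary_groupD(1)]
      by (simp add: distrib_right add.commute[of h] E_add assoc_mult_mat[of _ n n _ n _ n])
    then have "?S c \<le> ?S a' + h * ?T + real k * K * h\<^sup>2"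
      using step[OF V' E B(2) that(1)] Suc.prems by simp
    also have "?S a' \<le> ?S a + real m * (h * ?T + real k * K * h\<^sup>2)" by (rule Suc.IH[OF V'(1)])
    finally show ?case by (simp add: algebra_simps)
  qed
  have "?S c \<le> ?S a + ?T + real k * K / real (Suc m)" for m
  proof -
    have "?S c \<le> ?S a + real (Suc m) * (1 / real (Suc m) * ?T + real k * K * (1 / real (Suc m))\<^sup>2)"
      using iterate[of "1 / real (Suc m)" "Suc m" W c] AB E1 by simp
    also have "real (Suc m) * (1 / real (Suc m) * ?T + real k * K * (1 / real (Suc m))\<^sup>2)
        = ?T + real k * K / real (Suc m)"
      by (simp add: field_simps power2_eq_square del: of_nat_Suc)
    finally show ?thesis by simp
  qed
  moreover have "(\<lambda>m. ?S a + ?T + real k * K / real (Suc m)) \<longlonglongrightarrow> ?S a + ?T + 0"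
    by (intro tendsto_intros LIMSEQ_Suc[OF lim_const_over_n])
  ultimately show ?thesis using LIMSEQ_le_const[of _ "?S a + ?T + 0" "?S c"] by auto
qed

lemma partial_sum_angles_mult_le:
  assumes A: "angle_decomp n A V a" "sorted_angles n a"
    and B: "angle_decomp n B Z b" "sorted_angles n b"
    and AB: "angle_decomp n (A * B) W c" "sorted_angles n c" and k: "k \<le> n"
  shows "(\<Sum>j<k. \<bar>c j\<bar>) \<le> (\<Sum>l<k. \<bar>a l\<bar> + \<bar>b l\<bar>)"
proof -
  \<comment> \<open>The shift by 2 keeps \<open>\<rho> 0\<close> strictly positive.\<close>
  define \<rho> where "\<rho> m = 1 - inverse (real (Suc (Suc m)))" for m
  have \<rho>: "0 < \<rho> m" "\<rho> m < 1" for m by (auto simp: \<rho>_def field_simps)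
  have "\<rho> \<longlonglongrightarrow> 1 - 0"
    unfolding \<rho>_def by (intro tendsto_intros LIMSEQ_Suc[OF LIMSEQ_inverse_real_of_nat])
  then have \<rho>_lim: "\<rho> \<longlonglongrightarrow> 1" by simp
  have lim: "(\<lambda>m. \<Sum>j<k. arccos (\<rho> m * cos (a j))) \<longlonglongrightarrow> (\<Sum>j<k. \<bar>a j\<bar>)"
    if a: "sorted_angles n a" for a
  proof (rule tendsto_sum)
    fix j assume "j \<in> {..<k}"
    then have "\<bar>a j\<bar> \<le> pi" using a k by (auto simp: sorted_angles_def)
    then have eq: "\<bar>a j\<bar> = arccos (1 * cos (a j))" by (simp add: arccos_cos_eq_abs)
    have bnd: "\<bar>\<rho> m * cos (a j)\<bar> \<le> 1" for m
      using \<rho>[of m] by (simp add: abs_mult mult_le_one)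
    show "(\<lambda>m. arccos (\<rho> m * cos (a j))) \<longlonglongrightarrow> \<bar>a j\<bar>"
      unfolding eq
    proof (rule continuous_on_tendsto_compose[OF continuous_on_arccos'])
      show "(\<lambda>m. \<rho> m * cos (a j)) \<longlonglongrightarrow> 1 * cos (a j)"
        by (intro tendsto_intros \<rho>_lim)
      show "\<forall>\<^sub>F m in sequentially. \<rho> m * cos (a j) \<in> {-1..1}"
        using bnd by (auto simp: abs_le_iff minus_le_iff)
    qed auto
  qed
  have "(\<Sum>j<k. \<bar>c j\<bar>) \<le> (\<Sum>l<k. \<bar>a l\<bar>) + (\<Sum>l<k. \<bar>b l\<bar>)"
  proof (rule LIMSEQ_le[OF lim[OF AB(2)]])
    show "(\<lambda>m. (\<Sum>l<k. arccos (\<rho> m * cos (a l))) + (\<Sum>l<k. \<bar>b l\<bar>))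
        \<longlonglongrightarrow> (\<Sum>l<k. \<bar>a l\<bar>) + (\<Sum>l<k. \<bar>b l\<bar>)"
      by (intro tendsto_intros lim A)
    show "\<exists>N. \<forall>m\<ge>N. (\<Sum>j<k. arccos (\<rho> m * cos (c j)))
        \<le> (\<Sum>l<k. arccos (\<rho> m * cos (a l))) + (\<Sum>l<k. \<bar>b l\<bar>)"
      using arccos_scaled_sum_mult_le[OF \<rho> A B AB(1) k] by blast
  qed
  then show ?thesis by (simp add: sum.distrib)
qed


section \<open>The distance functions\<close>

context symmetric_norm
begin

text \<open>Any diagonalization with angles in \<open>[-pi, pi]\<close> may be used to compute the
  gauge: a different order of the angles is absorbed by permutation invariance of
  \<open>g\<close>.\<close>

lemma angle_gauge_eq:
  assumes decomp: "angle_decomp n A V b" and b: "\<And>i. i < n \<Longrightarrow> \<bar>b i\<bar> \<le> pi"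
  shows "angle_gauge g A = gv (\<lambda>i. \<bar>b i\<bar>)"
proof -
  have V: "V \<in> carrier (unitary_group n)"
    and A_eq: "A = V * mat_diag n (\<lambda>i. cis (b i)) * mat_adjoint V"
    using decomp by (auto simp: angle_decomp_def)
  have A: "A \<in> carrier (unitary_group n)" by (rule angle_decomp_unitary[OF decomp])
  \<comment> \<open>\<open>-pi\<close> is replaced by \<open>pi\<close>, the representative allowed
    in \<open>eigenangles\<close>; neither \<open>cis\<close> nor the absolute value
    changes.\<close>
  define b' where "b' i = (if b i = - pi then pi else b i)" for i
  have b': "cis (b' i) = cis (b i)" "\<bar>b' i\<bar> = \<bar>b i\<bar>" for i
    by (auto simp: b'_def complex_eq_iff)
  define ts where "ts = rev (sort (map b' [0..<n]))"
  have mset: "mset ts = mset (map b' [0..<n])" by (simp add: ts_def)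
  have "eigenangles A = ts"
    unfolding eigenangles_eq_iff[OF A]
  proof (intro conjI)
    have "mset (map (\<lambda>a. [:- cis a, 1:]) ts) = mset (map (\<lambda>a. [:- cis a, 1:]) (map b' [0..<n]))"
      by (simp only: mset_map mset)
    then have "(\<Prod>a\<leftarrow>ts. [:- cis a, 1:]) = (\<Prod>a\<leftarrow>map b' [0..<n]. [:- cis a, 1:])"
      by (metis prod_mset_prod_list)
    then show "char_poly A = (\<Prod>a\<leftarrow>ts. [:- cis a, 1:])"
      unfolding A_eq char_poly_diagonalized[OF V] by (simp add: comp_def b')
    show "sorted_wrt (\<ge>) ts" by (simp add: ts_def sorted_wrt_rev)
    show "set ts \<subseteq> {-pi<..pi}"
      using b by (force simp: ts_def b'_def abs_le_iff)
  qed
  moreover have "mset (map abs ts) = mset (map (\<lambda>i. \<bar>b i\<bar>) [0..<n])"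
  proof -
    have "mset (map abs ts) = mset (map abs (map b' [0..<n]))"
      by (simp only: mset_map mset)
    then show ?thesis by (simp add: comp_def b'(2))
  qed
  then obtain p where p: "p permutes {..<n}"
    and perm: "permute_list p (map (\<lambda>i. \<bar>b i\<bar>) [0..<n]) = map abs ts"
    by (rule mset_eq_permutation) simp
  have "vec_of_list (map abs ts) = vec n (\<lambda>i. \<bar>b (p i)\<bar>)"
  proof (rule eq_vecI)
    fix i assume "i < dim_vec (vec n (\<lambda>i. \<bar>b (p i)\<bar>))"
    then have i: "i < n" "p i < n" using permutes_in_image[OF p] by auto
    show "vec_of_list (map abs ts) $ i = vec n (\<lambda>i. \<bar>b (p i)\<bar>) $ i"
      unfolding perm[symmetric]
      using i p by (simp add: permute_list_nth vec_of_list_index del: map_map)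
  qed (simp add: ts_def)
  ultimately show ?thesis
    unfolding angle_gauge_def using gv_permute[OF p, of "\<lambda>i. \<bar>b i\<bar>"] by simp
qed

lemma angle_gauge_nonneg: "A \<in> carrier (unitary_group n) \<Longrightarrow> 0 \<le> angle_gauge g A"
  by (metis angle_gauge_eq nonneg sorted_angle_decomp_exists sorted_angles_def vec_carrier)

text \<open>The angles of \<open>A * B\<close> are weakly majorized by the sums
  \<open>\<bar>a i\<bar> + \<bar>b i\<bar>\<close>, and the triangle inequality of \<open>g\<close>
  separates the two summands.\<close>

lemma angle_gauge_mult_le:
  assumes A: "A \<in> carrier (unitary_group n)" and B: "B \<in> carrier (unitary_group n)"
  shows "angle_gauge g (A * B) \<le> angle_gauge g A + angle_gauge g B"
proof -
  obtain V a where a: "angle_decomp n A V a" "sorted_angles n a"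
    by (rule sorted_angle_decomp_exists[OF A])
  obtain Z b where b: "angle_decomp n B Z b" "sorted_angles n b"
    by (rule sorted_angle_decomp_exists[OF B])
  obtain W c where c: "angle_decomp n (A * B) W c" "sorted_angles n c"
    by (rule sorted_angle_decomp_exists[OF mult_in_unitary_group[OF A B]])
  have "gv (\<lambda>i. \<bar>c i\<bar>) \<le> gv (\<lambda>i. \<bar>a i\<bar> + \<bar>b i\<bar>)"
    using c(2) partial_sum_angles_mult_le[OF a b c]
    by (intro gv_le_of_weak_majorization) (auto simp: sorted_angles_def)
  also have "\<dots> \<le> gv (\<lambda>i. \<bar>a i\<bar>) + gv (\<lambda>i. \<bar>b i\<bar>)" by (rule gv_add_le)
  finally show ?thesis
    using a b c by (simp add: angle_gauge_eq[of _ _ a] angle_gauge_eq[of _ _ b]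
      angle_gauge_eq[of _ _ c] sorted_angles_def)
qed

text \<open>Taking the adjoint negates all angles, which keeps them in the closed interval
  \<open>[-pi, pi]\<close>.\<close>

lemma angle_gauge_adjoint:
  assumes A: "A \<in> carrier (unitary_group n)"
  shows "angle_gauge g (mat_adjoint A) = angle_gauge g A"
proof -
  obtain V a where a: "angle_decomp n A V a" "sorted_angles n a"
    by (rule sorted_angle_decomp_exists[OF A])
  then show ?thesis
    using angle_gauge_eq[OF a(1)] angle_gauge_eq[OF angle_decomp_adjoint[OF a(1)]]
    by (simp add: sorted_angles_def)
qed

lemma angle_decomp_cis_one: "angle_decomp n (cis t \<cdot>\<^sub>m 1\<^sub>m n) (1\<^sub>m n) (\<lambda>_. t)"
proof -
  have "cis t \<cdot>\<^sub>m 1\<^sub>m n = mat_diag n (\<lambda>_. cis t)"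
    by (rule eq_matI) (auto simp: mat_diag_def)
  moreover have "(1\<^sub>m n :: complex mat) \<in> carrier (unitary_group n)"
    by (rule unitary_groupI) auto
  ultimately show ?thesis
    unfolding angle_decomp_def
    by (simp add: right_mult_one_mat[OF mat_diag_dim] left_mult_one_mat[OF mat_diag_dim])
qed

lemma angle_gauge_cis_one: "\<bar>t\<bar> \<le> pi \<Longrightarrow> angle_gauge g (cis t \<cdot>\<^sub>m 1\<^sub>m n) = \<bar>t\<bar> * gv (\<lambda>_. 1)"
  using angle_gauge_eq[OF angle_decomp_cis_one, of t] gv_scale[of "\<bar>t\<bar>" "\<lambda>_. 1"] by simp

lemma angle_gauge_eq_0_iff:
  assumes A: "A \<in> carrier (unitary_group n)"
  shows "angle_gauge g A = 0 \<longleftrightarrow> A = 1\<^sub>m n"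
proof
  obtain V a where a: "angle_decomp n A V a" "sorted_angles n a"
    by (rule sorted_angle_decomp_exists[OF A])
  assume "angle_gauge g A = 0"
  then have "vec n (\<lambda>i. \<bar>a i\<bar>) = 0\<^sub>v n"
    using angle_gauge_eq[OF a(1)] a(2) eq_zero_iff by (simp add: sorted_angles_def)
  then have "a i = 0" if "i < n" for i
    using that by (metis abs_eq_0 index_vec index_zero_vec(1))
  then have "mat_diag n (\<lambda>i. cis (a i)) = mat_diag n (\<lambda>i. cis 0)"
    by (intro eq_matI) (auto simp: mat_diag_def)
  then have "angle_decomp n A V (\<lambda>_. 0)"
    using a(1) by (simp add: angle_decomp_def)
  then show "A = 1\<^sub>m n" by (rule angle_decomp_zero)
next
  have "cis 0 \<cdot>\<^sub>m 1\<^sub>m n = (1\<^sub>m n :: complex mat)" by (rule eq_matI) auto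
  moreover assume "A = 1\<^sub>m n"
  ultimately show "angle_gauge g A = 0" using angle_gauge_cis_one[of 0] by simp
qed

text \<open>A phase change is multiplication by a scalar matrix. For
  \<open>\<bar>r - s\<bar> \<le> pi\<close> the gauge of that matrix is
  \<open>\<bar>r - s\<bar>\<close> times \<open>g\<close> of the all-ones vector.\<close>

lemma angle_gauge_phase_diff_le:
  assumes A: "A \<in> carrier (unitary_group n)" and "\<bar>r - s\<bar> \<le> pi"
  shows "angle_gauge g (cis r \<cdot>\<^sub>m A) \<le> angle_gauge g (cis s \<cdot>\<^sub>m A) + \<bar>r - s\<bar> * gv (\<lambda>_. 1)"
proof -
  have a: "A \<in> carrier_mat n n" using unitary_groupD(1)[OF A] .
  have "cis r \<cdot>\<^sub>m A = (cis (r - s) \<cdot>\<^sub>m 1\<^sub>m n) * (cis s \<cdot>\<^sub>m A)"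
    using a by (subst mult_smult_assoc_mat[of _ n n _ n])
      (auto simp: cis_mult mult.assoc[symmetric] intro!: eq_matI)
  moreover have "angle_gauge g ((cis (r - s) \<cdot>\<^sub>m 1\<^sub>m n) * (cis s \<cdot>\<^sub>m A))
      \<le> angle_gauge g (cis (r - s) \<cdot>\<^sub>m 1\<^sub>m n) + angle_gauge g (cis s \<cdot>\<^sub>m A)"
    by (intro angle_gauge_mult_le cis_smult_in_unitary_group A
        angle_decomp_unitary[OF angle_decomp_cis_one])
  ultimately show ?thesis using angle_gauge_cis_one[OF assms(2)] by simp
qed

section \<open>Minimization over the phase\<close>

lemma continuous_angle_gauge_phase:
  assumes A: "A \<in> carrier (unitary_group n)"
  shows "isCont (\<lambda>r. angle_gauge g (cis r \<cdot>\<^sub>m A)) s"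
proof -
  let ?f = "\<lambda>r. angle_gauge g (cis r \<cdot>\<^sub>m A)"
  have "\<forall>\<^sub>F r in at s. norm (?f r - ?f s) \<le> \<bar>r - s\<bar> * gv (\<lambda>_. 1)"
  proof (rule eventually_at[THEN iffD2], intro exI[of _ pi] conjI ballI impI)
    fix r assume "r \<noteq> s \<and> dist r s < pi"
    then have "\<bar>r - s\<bar> \<le> pi" "\<bar>s - r\<bar> \<le> pi" by (auto simp: dist_real_def)
    then show "norm (?f r - ?f s) \<le> \<bar>r - s\<bar> * gv (\<lambda>_. 1)"
      using angle_gauge_phase_diff_le[OF A, of r s] angle_gauge_phase_diff_le[OF A, of s r]
      by (auto simp: abs_le_iff abs_minus_commute)
  qed simp
  moreover have "((\<lambda>r. \<bar>r - s\<bar> * gv (\<lambda>_. 1)) \<longlongrightarrow> 0) (at s)"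
    by (auto intro!: tendsto_eq_intros)
  ultimately have "((\<lambda>r. ?f r - ?f s) \<longlongrightarrow> 0) (at s)"
    by (rule Lim_null_comparison)
  then show ?thesis unfolding isCont_def by (rule LIM_zero_cancel)
qed

text \<open>A continuous function attains its minimum on the compact interval, and periodicity with
  period \<open>2 * pi\<close> makes this minimum global.\<close>

lemma phase_minimum:
  assumes A: "A \<in> carrier (unitary_group n)"
  obtains r where "r \<in> {r0..r0 + 2 * pi}"
    "\<And>s. angle_gauge g (cis r \<cdot>\<^sub>m A) \<le> angle_gauge g (cis s \<cdot>\<^sub>m A)"
proof -
  have "continuous_on {r0..r0 + 2 * pi} (\<lambda>r. angle_gauge g (cis r \<cdot>\<^sub>m A))"
    by (intro continuous_at_imp_continuous_on ballI continuous_angle_gauge_phase A)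
  then obtain r where r: "r \<in> {r0..r0 + 2 * pi}"
    "\<And>s. s \<in> {r0..r0 + 2 * pi} \<Longrightarrow> angle_gauge g (cis r \<cdot>\<^sub>m A) \<le> angle_gauge g (cis s \<cdot>\<^sub>m A)"
    using continuous_attains_inf[of "{r0..r0 + 2 * pi}" "\<lambda>r. angle_gauge g (cis r \<cdot>\<^sub>m A)"] by auto
  show thesis
  proof
    fix s :: real
    \<comment> \<open>The number of full turns that carries \<open>s\<close> into the given
      interval.\<close>
    define m where "m = \<lfloor>(s - r0) / (2 * pi)\<rfloor>"
    define s' where "s' = s - of_int m * (2 * pi)"
    have "of_int m \<le> (s - r0) / (2 * pi)" "(s - r0) / (2 * pi) < of_int m + 1"
      unfolding m_def by linarith+
    then have "s' \<in> {r0..r0 + 2 * pi}"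
      unfolding s'_def by (auto simp: field_simps)
    moreover have "cis s = cis s' * cis (2 * pi * of_int m)"
      unfolding s'_def by (simp add: cis_mult algebra_simps)
    then have "cis s' = cis s" using cis_multiple_2pi[of "of_int m"] by simp
    ultimately show "angle_gauge g (cis r \<cdot>\<^sub>m A) \<le> angle_gauge g (cis s \<cdot>\<^sub>m A)"
      using r(2)[of s'] by simp
  qed fact
qed

end

theorem proposition2:
  fixes n :: nat and g :: "real Matrix.vec \<Rightarrow> real"
  assumes "n \<ge> 1" and "symmetric_norm n g"
  shows "Metric_space (carrier (unitary_group n)) (unitary_dist n g)
    \<and> Pseudometric_space (carrier (unitary_group n)) (unitary_phase_dist n g)
    \<and> (\<forall>X \<in> carrier (unitary_group n). \<forall>Y \<in> carrier (unitary_group n).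
        (\<exists>r. phase_gauge n g X Y r = unitary_phase_dist n g X Y
             \<and> (\<forall>s. phase_gauge n g X Y r \<le> phase_gauge n g X Y s))
        \<and> (\<forall>r0. \<exists>r \<in> {r0..r0 + 2 * pi}. phase_gauge n g X Y r = unitary_phase_dist n g X Y))"
proof -
  interpret symmetric_norm n g by fact
  let ?U = "carrier (unitary_group n)"
  \<comment> \<open>On the unitary group the adjoint is the inverse, so \<open>Q X Y\<close> is the
    quotient of \<open>X\<close> by \<open>Y\<close>.\<close>
  define Q where "Q X Y = X * mat_adjoint Y" for X Y :: "complex mat"
  have Q: "Q X Y \<in> ?U" if "X \<in> ?U" "Y \<in> ?U" for X Y
    using that unfolding Q_def by (intro mult_in_unitary_group adjoint_in_unitary_group)
  have Q_adjoint: "mat_adjoint (Q X Y) = Q Y X" if "X \<in> ?U" "Y \<in> ?U" for X Y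
    using that[THEN unitary_groupD(1)] unfolding Q_def by (simp add: mat_adjoint_mult[of _ n n _ n])
  have Q_one: "Q X X = 1\<^sub>m n" if "X \<in> ?U" for X
    using unitary_groupD(3)[OF that] by (simp add: Q_def)
  have Q_eq_one: "X = Y" if "X \<in> ?U" "Y \<in> ?U" "Q X Y = 1\<^sub>m n" for X Y
    using unitary_mult_cancel(4)[OF that(2) unitary_groupD(1)[OF that(1)]] that(3)
      unitary_groupD(1)[OF that(2)] by (simp add: Q_def)
  have Q_mult: "Q X Z = Q X Y * Q Y Z" if "X \<in> ?U" "Y \<in> ?U" "Z \<in> ?U" for X Y Z
  proof -
    note c = that[THEN unitary_groupD(1)]
    have "Q X Y * Q Y Z = X * mat_adjoint Y * Y * mat_adjoint Z"
      using c unfolding Q_def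
      by (intro assoc_mult_mat[of _ n n _ n _ n, symmetric]) (auto intro: mult_carrier_mat[of _ n n _ n])
    then show ?thesis using unitary_mult_cancel(4)[OF that(2) c(1)] by (simp add: Q_def)
  qed
  have dist: "unitary_dist n g X Y = angle_gauge g (Q X Y)" if "X \<in> ?U" "Y \<in> ?U" for X Y
    using that by (simp add: unitary_dist_def inv_unitary_group Q_def)
  have phase: "phase_gauge n g X Y r = angle_gauge g (cis r \<cdot>\<^sub>m Q X Y)" if "Y \<in> ?U" for X Y r
    using that by (simp add: phase_gauge_def inv_unitary_group Q_def)
  \<comment> \<open>A single \<open>r\<close> in the given interval both realizes the infimum and
    minimizes over all reals.\<close>
  have attained: "\<exists>r \<in> {r0..r0 + 2 * pi}. phase_gauge n g X Y r = unitary_phase_dist n g X Y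
      \<and> (\<forall>s. phase_gauge n g X Y r \<le> phase_gauge n g X Y s)"
    if XY: "X \<in> ?U" "Y \<in> ?U" for X Y r0
  proof -
    obtain r where r: "r \<in> {r0..r0 + 2 * pi}"
      "\<And>s. phase_gauge n g X Y r \<le> phase_gauge n g X Y s"
      using phase_minimum[OF Q[OF XY], of r0] unfolding phase[OF XY(2)] by blast
    have "(INF s. phase_gauge n g X Y s) = phase_gauge n g X Y r"
      using r(2) by (intro cInf_eq_minimum) auto
    then show ?thesis using r XY by (auto simp: unitary_phase_dist_def)
  qed
  have phase_nonneg: "0 \<le> phase_gauge n g X Y r" if "X \<in> ?U" "Y \<in> ?U" for X Y r
    unfolding phase[OF that(2)] by (intro angle_gauge_nonneg cis_smult_in_unitary_group Q that)
  have phase_dist_le: "unitary_phase_dist n g X Y \<le> phase_gauge n g X Y r"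
    if "X \<in> ?U" "Y \<in> ?U" for X Y r
    using attained[OF that, of 0] by metis
  \<comment> \<open>The adjoint exchanges \<open>X\<close> and \<open>Y\<close> and negates the
    phase, so both orders have the same values over all phases.\<close>
  have phase_commute: "phase_gauge n g Y X (- r) = phase_gauge n g X Y r"
    if XY: "X \<in> ?U" "Y \<in> ?U" for X Y r
  proof -
    have "mat_adjoint (cis r \<cdot>\<^sub>m Q X Y) = cis (- r) \<cdot>\<^sub>m mat_adjoint (Q X Y)"
      by (rule eq_matI) (auto simp: cis_cnj)
    then show ?thesis
      using angle_gauge_adjoint[OF cis_smult_in_unitary_group[OF Q[OF XY]], of r] XY
      by (simp add: phase Q_adjoint)
  qed
  \<comment> \<open>Phases add along a product, so the sum of the two minimizing phases is a
    candidate for the pair \<open>X\<close>, \<open>Z\<close>.\<close>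
  have phase_triangle: "phase_gauge n g X Z (r + s) \<le> phase_gauge n g X Y r + phase_gauge n g Y Z s"
    if "X \<in> ?U" "Y \<in> ?U" "Z \<in> ?U" for X Y Z r s
  proof -
    have q: "Q X Y \<in> carrier_mat n n" "Q Y Z \<in> carrier_mat n n"
      using Q that by (auto dest: unitary_groupD(1))
    have "cis (r + s) \<cdot>\<^sub>m Q X Z = (cis r \<cdot>\<^sub>m Q X Y) * (cis s \<cdot>\<^sub>m Q Y Z)"
      using q by (simp add: Q_mult[OF that] mult_smult_assoc_mat[of _ n n _ n]
          mult_smult_distrib[of _ n n _ n] flip: cis_mult) (auto intro!: eq_matI)
    then show ?thesis
      using angle_gauge_mult_le[OF cis_smult_in_unitary_group[OF Q[OF that(1,2)]]
          cis_smult_in_unitary_group[OF Q[OF that(2,3)]], of r s] that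
      by (simp add: phase)
  qed
  have "Metric_space ?U (unitary_dist n g)"
  proof
    show "0 \<le> unitary_dist n g X Y" for X Y
      by (cases "X \<in> ?U \<and> Y \<in> ?U")
        (auto simp: dist intro!: angle_gauge_nonneg Q, auto simp: unitary_dist_def)
    show "unitary_dist n g X Y = unitary_dist n g Y X" for X Y
    proof (cases "X \<in> ?U \<and> Y \<in> ?U")
      case True
      then show ?thesis using angle_gauge_adjoint[OF Q[of X Y]] by (simp add: dist Q_adjoint)
    qed (auto simp: unitary_dist_def)
    show "unitary_dist n g X Y = 0 \<longleftrightarrow> X = Y" if "X \<in> ?U" "Y \<in> ?U" for X Y
      using that angle_gauge_eq_0_iff[OF Q[OF that]] Q_one Q_eq_one by (auto simp: dist)
    show "unitary_dist n g X Z \<le> unitary_dist n g X Y + unitary_dist n g Y Z"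
      if "X \<in> ?U" "Y \<in> ?U" "Z \<in> ?U" for X Y Z
      using that angle_gauge_mult_le[OF Q[OF that(1,2)] Q[OF that(2,3)]]
      by (simp add: dist Q_mult[OF that, symmetric])
  qed
  moreover have "Pseudometric_space ?U (unitary_phase_dist n g)"
  proof
    show "0 \<le> unitary_phase_dist n g X Y" for X Y
    proof (cases "X \<in> ?U \<and> Y \<in> ?U")
      case True
      then show ?thesis using attained[of X Y 0] phase_nonneg[of X Y] by metis
    qed (auto simp: unitary_phase_dist_def)
    have le: "unitary_phase_dist n g Y X \<le> unitary_phase_dist n g X Y"
      if XY: "X \<in> ?U" "Y \<in> ?U" for X Y
      using attained[OF XY, of 0] phase_dist_le[OF XY(2,1)] phase_commute[OF XY] by metis
    show "unitary_phase_dist n g X Y = unitary_phase_dist n g Y X" for X Y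
    proof (cases "X \<in> ?U \<and> Y \<in> ?U")
      case True
      then show ?thesis using le[of X Y] le[of Y X] by simp
    qed (auto simp: unitary_phase_dist_def)
    show "unitary_phase_dist n g X X = 0" if X: "X \<in> ?U" for X
    proof (rule antisym)
      have "cis 0 \<cdot>\<^sub>m Q X X = 1\<^sub>m n" by (rule eq_matI) (auto simp: Q_one X)
      then have "phase_gauge n g X X 0 = 0"
        using angle_gauge_eq_0_iff[of "1\<^sub>m n"] Q[OF X X] by (simp add: phase X Q_one)
      then show "unitary_phase_dist n g X X \<le> 0" using phase_dist_le[OF X X, of 0] by simp
      show "0 \<le> unitary_phase_dist n g X X"
        using attained[OF X X, of 0] phase_nonneg[OF X X] by metis
    qed
    show "unitary_phase_dist n g X Z \<le> unitary_phase_dist n g X Y + unitary_phase_dist n g Y Z"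
      if XYZ: "X \<in> ?U" "Y \<in> ?U" "Z \<in> ?U" for X Y Z
    proof -
      obtain r s where "phase_gauge n g X Y r = unitary_phase_dist n g X Y"
        "phase_gauge n g Y Z s = unitary_phase_dist n g Y Z"
        using attained[OF XYZ(1,2), of 0] attained[OF XYZ(2,3), of 0] by metis
      then show ?thesis
        using phase_triangle[OF XYZ, of r s] phase_dist_le[OF XYZ(1,3), of "r + s"] by simp
    qed
  qed
  ultimately show ?thesis using attained by meson
qed

end
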